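(* Let $X_1,\dots,X_n$ be i.i.d. with distribution $P_{\theta_0}$, where $P_{\theta_0}$ is not assumed to belong to the model $\{P_\theta:\theta\in\Theta\}$. Let $\pi$ be a prior on $\Theta$ and $\mathcal{F}\subset\mathcal{M}_1^+(\Theta)$. Assume that, for $\theta^*=\arg\min_{\theta\in\Theta} \mathcal{K}(P_{\theta_0},P_\theta)$, there are $\varepsilon_n>0$ and $\rho_n\in\mathcal{F}$ with $$\int \mathbb{E}\left[\log\frac{ p_{\theta^*}(X_i)}{ p_{\theta}(X_i)}\right]\rho_n(\mathrm{d}\theta) \leq \varepsilon_n \quad\text{and}\quad \mathcal{K}(\rho_n,\pi) \leq n \varepsilon_n .$$ Then, for any $\alpha\in(0,1)$, $$\mathbb{E} \left[ \int D_{\alpha}(P_{\theta},P_{\theta_0})\, \tilde{\pi}_{n,\alpha}(\mathrm{d}\theta|X_1^n)\right] \leq \frac{\alpha}{1-\alpha} \min_{\theta\in\Theta} \mathcal{K}(P_{\theta_0},P_{\theta})+ \frac{1+\alpha}{1-\alpha}\,\varepsilon_n .$$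
   Context: $\{P_\theta:\theta\in\Theta\}$ is a statistical model. The index $\theta_0$ is an extra symbol, possibly with $\theta_0\notin\Theta$, and the extended family $\{P_\theta:\theta\in\Theta\cup\{\theta_0\}\}$ is dominated by a measure $Q$, with densities $p_\theta=\mathrm{d}P_\theta/\mathrm{d}Q$. $\Theta$ carries a $\sigma$-algebra and $\mathcal{M}_1^+(\Theta)$ is the set of all probability measures on $\Theta$. $\mathbb{E}$ is the expectation under $\mathbb{P}=P_{\theta_0}^{\otimes n}$, the law of $X_1^n=(X_1,\dots,X_n)$. The minimizer $\theta^*$ is assumed to exist. $r_n(\theta,\theta')=\sum_{i=1}^n\log\frac{p_{\theta'}(X_i)}{p_\theta(X_i)}$; $(X_1^n,\theta)\mapsto r_n(\theta,\theta_0)$ is assumed jointly measurable (and the regularity needed for the quantities involved to be measurable is implicitly assumed). $D_\alpha(P,R)=\frac{1}{\alpha-1}\log\int\left(\frac{\mathrm{d}P}{\mathrm{d}\mu}\right)^\alpha\left(\frac{\mathrm{d}R}{\mathrm{d}\mu}\right)^{1-\alpha}\mathrm{d}\mu$ for any $\mu$ dominating $P,R$. $\mathcal{K}(P,R)=\int\log\frac{\mathrm{d}P}{\mathrm{d}R}\,\mathrm{d}P$ if $P\ll R$, $+\infty$ otherwise. Tempered posterior: $\pi_{n,\alpha}(\mathrm{d}\theta|X_1^n)\propto e^{-\alpha r_n(\theta,\theta_0)}\pi(\mathrm{d}\theta)\propto\left(\prod_i p_\theta(X_i)\right)^\alpha\pi(\mathrm{d}\theta)$. Variational approximation: $\tilde\pi_{n,\alpha}(\cdot|X_1^n)=\arg\min_{\rho\in\mathcal{F}}\mathcal{K}(\rho,\pi_{n,\alpha}(\cdot|X_1^n))$,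 equivalently $\tilde\pi_{n,\alpha}(\cdot|X_1^n)=\arg\min_{\rho\in\mathcal{F}}\left\{\alpha\int r_n(\theta,\theta_0)\rho(\mathrm{d}\theta)+\mathcal{K}(\rho,\pi)\right\}$; a minimizer is assumed to exist and $\tilde\pi_{n,\alpha}$ denotes any such minimizer. (An indeterminate $\infty-\infty$ value of $\alpha\int r_n\mathrm{d}\rho+\mathcal{K}(\rho,\pi)$ is read as $+\infty$.) *)

theory Defs
  imports "HOL-Probability.Probability"
begin

text \<open>
  Log-likelihood ratios and Kullback divergences may be infinite, so logarithm, exponential and
  integral are taken with extended real values.
\<close>

definition ln_ennreal :: "ennreal \<Rightarrow> ereal" where
  "ln_ennreal x = (if x = 0 then -\<infinity> else if x = \<top> then \<infinity> else ereal (ln (enn2real x)))"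

definition exp_ereal :: "ereal \<Rightarrow> ennreal" where
  "exp_ereal x = (if x = -\<infinity> then 0 else if x = \<infinity> then \<top> else ennreal (exp (real_of_ereal x)))"

text \<open>
  The quasi-integral: integral of the positive part minus integral of the negative part
  (\<^const>\<open>e2ennreal\<close> sends negative arguments to 0). In the type \<^typ>\<open>ereal\<close>,
  \<^prop>\<open>(\<infinity>::ereal) - \<infinity> = \<infinity>\<close> and \<^prop>\<open>-\<infinity> + \<infinity> = (\<infinity>::ereal)\<close>,
  so an indeterminate value is read as \<^term>\<open>\<infinity>::ereal\<close>.
\<close>

definition ereal_integral :: "'a measure \<Rightarrow> ('a \<Rightarrow> ereal) \<Rightarrow> ereal" where
  "ereal_integral M f =
     enn2ereal (\<integral>\<^sup>+ x. e2ennreal (f x) \<partial>M) - enn2ereal (\<integral>\<^sup>+ x. e2ennreal (- f x) \<partial>M)"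

text \<open>
  \<open>K(P, R)\<close>. The library's \<^const>\<open>KL_divergence\<close> is real-valued (and has its arguments in the
  opposite order), so it cannot express the value infinity. Note that
  \<^term>\<open>absolutely_continuous R P\<close> is \<open>P << R\<close> and \<^term>\<open>RN_deriv R P\<close> is \<open>dP/dR\<close>.
\<close>

definition kullback :: "'a measure \<Rightarrow> 'a measure \<Rightarrow> ereal" where
  "kullback P R =
     (if absolutely_continuous R P then ereal_integral P (\<lambda>x. ln_ennreal (RN_deriv R P x)) else \<infinity>)"

text \<open>
  \<open>D_\<alpha>(P, R)\<close> for \<open>0 < \<alpha> < 1\<close> and probability measures \<open>P\<close>, \<open>R\<close>, computed with a dominating
  measure \<open>\<mu>\<close>, on which the value does not depend. It is infinite if \<open>P\<close> and \<open>R\<close> are mutually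
  singular. The derivatives are finite \<open>\<mu>\<close>-almost everywhere, so \<^const>\<open>enn2real\<close> loses nothing.
\<close>

definition renyi_divergence :: "'a measure \<Rightarrow> real \<Rightarrow> 'a measure \<Rightarrow> 'a measure \<Rightarrow> ereal" where
  "renyi_divergence \<mu> \<alpha> P R =
     ereal (1 / (\<alpha> - 1)) *
     ln_ennreal (\<integral>\<^sup>+ x. ennreal (enn2real (RN_deriv \<mu> P x) powr \<alpha> *
                                enn2real (RN_deriv \<mu> R x) powr (1 - \<alpha>)) \<partial>\<mu>)"

text \<open>
  \<open>log (g x / f x)\<close>; here \<open>a / 0 = \<infinity>\<close> for \<open>a > 0\<close> and \<open>0 / 0 = 0\<close> in \<^typ>\<open>ennreal\<close>.
\<close>

definition log_ratio :: "('a \<Rightarrow> real) \<Rightarrow> ('a \<Rightarrow> real) \<Rightarrow> 'a \<Rightarrow> ereal" where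
  "log_ratio g f x = ln_ennreal (ennreal (g x) / ennreal (f x))"

text \<open>
  \<open>r_n(\<theta>, \<theta>')\<close> at the sample \<open>x = (x 1, ..., x n)\<close>, for densities \<open>f = p_\<theta>\<close> and \<open>g = p_\<theta>'\<close>.
\<close>

definition neg_log_lr :: "nat \<Rightarrow> ('a \<Rightarrow> real) \<Rightarrow> ('a \<Rightarrow> real) \<Rightarrow> (nat \<Rightarrow> 'a) \<Rightarrow> ereal" where
  "neg_log_lr n f g x = (\<Sum>i\<in>{1..n}. log_ratio g f (x i))"

text \<open>
  The tempered posterior for the prior \<open>\<pi>\<close>, where \<open>r \<theta>\<close> is the value of \<open>r_n(\<theta>, \<theta>\<^sub>0)\<close> at
  the observed sample.
\<close>

definition tempered_posterior :: "real \<Rightarrow> 't measure \<Rightarrow> ('t \<Rightarrow> ereal) \<Rightarrow> 't measure" where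
  "tempered_posterior \<alpha> \<pi> r =
     density \<pi> (\<lambda>\<theta>. exp_ereal (- (ereal \<alpha> * r \<theta>)) / (\<integral>\<^sup>+ \<theta>'. exp_ereal (- (ereal \<alpha> * r \<theta>')) \<partial>\<pi>))"

definition is_variational_approx ::
    "'t measure set \<Rightarrow> real \<Rightarrow> 't measure \<Rightarrow> ('t \<Rightarrow> ereal) \<Rightarrow> 't measure \<Rightarrow> bool" where
  "is_variational_approx F \<alpha> \<pi> r \<rho> \<longleftrightarrow>
     is_arg_min (\<lambda>\<rho>. kullback \<rho> (tempered_posterior \<alpha> \<pi> r)) (\<lambda>\<rho>. \<rho> \<in> F) \<rho>"

lemma renyi_divergence_density:
  fixes f g :: "'a \<Rightarrow> real"
  assumes f: "f \<in> borel_measurable \<mu>" "\<And>x. x \<in> space \<mu> \<Longrightarrow> 0 \<le> f x"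
    and g: "g \<in> borel_measurable \<mu>" "\<And>x. x \<in> space \<mu> \<Longrightarrow> 0 \<le> g x"
    and P: "P = density \<mu> (\<lambda>x. ennreal (f x))" "finite_measure P"
    and R: "R = density \<mu> (\<lambda>x. ennreal (g x))" "finite_measure R"
  shows "renyi_divergence \<mu> \<alpha> P R =
    ereal (1 / (\<alpha> - 1)) * ln_ennreal (\<integral>\<^sup>+ x. ennreal (f x powr \<alpha> * g x powr (1 - \<alpha>)) \<partial>\<mu>)"
proof -
  have *: "AE x in \<mu>. enn2real (RN_deriv \<mu> N x) = h x"
    if h: "h \<in> borel_measurable \<mu>" "\<And>x. x \<in> space \<mu> \<Longrightarrow> 0 \<le> h x"
      and N: "N = density \<mu> (\<lambda>x. ennreal (h x))" "finite_measure N"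
    for h :: "'a \<Rightarrow> real" and N
  proof -
    have m: "(\<lambda>x. ennreal (h x)) \<in> borel_measurable \<mu>" using h by auto
    have d: "density \<mu> (RN_deriv \<mu> N) = N" using RN_derivI[OF m] N(1) by simp
    have "(\<integral>\<^sup>+ x. RN_deriv \<mu> N x \<partial>\<mu>) = emeasure (density \<mu> (RN_deriv \<mu> N)) (space \<mu>)"
      by (subst emeasure_density) (auto intro!: nn_integral_cong)
    also have "\<dots> \<noteq> \<infinity>"
      unfolding d using N(2) by (simp add: finite_measure.emeasure_finite)
    finally have "AE x in \<mu>. RN_deriv \<mu> N x = ennreal (h x)"
      using finite_density_unique[OF borel_measurable_RN_deriv m] d N(1) by simp
    then show ?thesis
      using AE_space by eventually_elim (simp add: h(2))
  qed
  have "(\<integral>\<^sup>+ x. ennreal (enn2real (RN_deriv \<mu> P x) powr \<alpha> *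
            enn2real (RN_deriv \<mu> R x) powr (1 - \<alpha>)) \<partial>\<mu>) =
        (\<integral>\<^sup>+ x. ennreal (f x powr \<alpha> * g x powr (1 - \<alpha>)) \<partial>\<mu>)"
  proof (rule nn_integral_cong_AE)
    show "AE x in \<mu>. ennreal (enn2real (RN_deriv \<mu> P x) powr \<alpha> *
            enn2real (RN_deriv \<mu> R x) powr (1 - \<alpha>)) = ennreal (f x powr \<alpha> * g x powr (1 - \<alpha>))"
      by (rule eventually_elim2[OF *[OF f P] *[OF g R]]) simp_all
  qed
  then show ?thesis
    by (simp add: renyi_divergence_def)
qed

end

theory Submission
  imports Defs
begin

text \<open>
  Let \<open>A \<theta> = \<integral> p\<^sub>\<theta>\<^sup>\<alpha> p\<^sub>0\<^sup>1\<^sup>-\<^sup>\<alpha> dQ = E exp (-\<alpha> log (p\<^sub>0 / p\<^sub>\<theta>))\<close>, so that \<open>n (1 - \<alpha>) D\<^sub>\<alpha> = log (A \<theta>)\<^sup>-\<^sup>n\<close>.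
  The Donsker-Varadhan inequality with respect to the tempered posterior, applied to this function
  and the variational approximation, together with minimality against \<open>\<rho>\<close>, gives
  \<open>n (1 - \<alpha>) \<integral> D\<^sub>\<alpha> d\<pi>t \<le> \<alpha> \<integral> r d\<rho> + K(\<rho>, \<pi>) + log W\<close> with \<open>W = \<integral> (A \<theta>)\<^sup>-\<^sup>n exp (-\<alpha> r \<theta>) \<pi>(d\<theta>)\<close>;
  the normalising constant of the posterior cancels. By Fubini \<open>E W \<le> 1\<close>, and \<open>log W \<le> W - 1\<close>
  makes the last term vanish in expectation.
\<close>

section \<open>Quasi-integrals of extended-real functions\<close>

lemma ereal_integral_cong_AE:
  assumes "AE x in M. f x = g x"
  shows "ereal_integral M f = ereal_integral M g"
proof -
  have "(\<integral>\<^sup>+ x. e2ennreal (f x) \<partial>M) = (\<integral>\<^sup>+ x. e2ennreal (g x) \<partial>M)"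
    by (rule nn_integral_cong_AE) (use assms in eventually_elim, simp)
  moreover have "(\<integral>\<^sup>+ x. e2ennreal (- f x) \<partial>M) = (\<integral>\<^sup>+ x. e2ennreal (- g x) \<partial>M)"
    by (rule nn_integral_cong_AE) (use assms in eventually_elim, simp)
  ultimately show ?thesis by (simp add: ereal_integral_def)
qed

lemma ereal_integral_nonneg_eq:
  assumes "AE x in M. 0 \<le> f x"
  shows "ereal_integral M f = enn2ereal (\<integral>\<^sup>+ x. e2ennreal (f x) \<partial>M)"
proof -
  have "(\<integral>\<^sup>+ x. e2ennreal (- f x) \<partial>M) = (\<integral>\<^sup>+ x. 0 \<partial>M)"
    by (rule nn_integral_cong_AE) (use assms in eventually_elim, simp add: e2ennreal_neg)
  then show ?thesis by (simp add: ereal_integral_def zero_ennreal.rep_eq)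
qed

lemma ereal_integral_eq_integral:
  fixes h :: "'a \<Rightarrow> real"
  assumes "integrable M h"
  shows "ereal_integral M (\<lambda>x. ereal (h x)) = ereal (\<integral>x. h x \<partial>M)"
proof -
  have "(\<integral>\<^sup>+ x. ennreal (h x) \<partial>M) \<noteq> \<top>" "(\<integral>\<^sup>+ x. ennreal (- h x) \<partial>M) \<noteq> \<top>"
    using assms by (auto simp: real_integrable_def)
  then show ?thesis
    unfolding ereal_integral_def real_lebesgue_integral_def[OF assms]
    by (cases "\<integral>\<^sup>+ x. ennreal (h x) \<partial>M"; cases "\<integral>\<^sup>+ x. ennreal (- h x) \<partial>M") auto
qed

text \<open>Once the negative part has finite mass, the quasi-integral is a genuine difference and
  can reach \<infinity> only through its positive part.\<close>

lemma integrable_if_ereal_integral_finite: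
  fixes h :: "'a \<Rightarrow> real"
  assumes h: "h \<in> borel_measurable M"
    and neg: "(\<integral>\<^sup>+ x. ennreal (- h x) \<partial>M) \<noteq> \<top>"
    and fin: "ereal_integral M (\<lambda>x. ereal (h x)) \<noteq> \<infinity>"
  shows "integrable M h"
proof -
  have "(\<integral>\<^sup>+ x. ennreal (h x) \<partial>M) \<noteq> \<top>"
    using fin neg unfolding ereal_integral_def
    by (cases "\<integral>\<^sup>+ x. ennreal (- h x) \<partial>M") auto
  with h neg show ?thesis by (simp add: real_integrable_def)
qed

section \<open>Kullback divergence through a real density; the Donsker-Varadhan inequality\<close>

text \<open>The density agrees with \<open>RN_deriv M N\<close> almost everywhere, which gives the
  formula for the divergence. For the last bound, \<open>ln t \<le> t - 1\<close> at
  \<open>t = 1 / d x\<close> yields \<open>d x * (- ln (d x)) \<le> 1\<close>. So the negative part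
  of the Kullback integrand always has finite mass, and the divergence is never of the form
  \<infinity> - \<infinity>.\<close>

lemma density_log_facts:
  fixes d :: "'a \<Rightarrow> real"
  assumes M: "prob_space M" and N: "prob_space N"
    and d[measurable]: "d \<in> borel_measurable M"
    and eq: "N = density M (\<lambda>x. ennreal (d x))"
  shows "AE x in N. 0 < d x"
    and "kullback N M = ereal_integral N (\<lambda>x. ereal (ln (d x)))"
    and "(\<integral>\<^sup>+ x. ennreal (- ln (d x)) \<partial>N) \<le> 1"
proof -
  interpret M: prob_space M by fact
  show pos: "AE x in N. 0 < d x"
    unfolding eq by (subst AE_density) (auto simp: ennreal_neg intro!: AE_I2)
  have ac: "absolutely_continuous M N"
    unfolding eq by (rule absolutely_continuousI_density) simp
  have "AE x in M. ennreal (d x) = RN_deriv M N x"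
    by (rule M.RN_deriv_unique) (simp_all add: eq)
  then have "AE x in N. ennreal (d x) = RN_deriv M N x"
    by (intro absolutely_continuous_AE[OF _ ac]) (simp_all add: eq)
  with pos have "AE x in N. ln_ennreal (RN_deriv M N x) = ereal (ln (d x))"
  proof eventually_elim
    case (elim x)
    from elim(2)[symmetric] elim(1) show ?case by (simp add: ln_ennreal_def)
  qed
  then show "kullback N M = ereal_integral N (\<lambda>x. ereal (ln (d x)))"
    using ac by (simp add: kullback_def) (rule ereal_integral_cong_AE)
  have "(\<integral>\<^sup>+ x. ennreal (- ln (d x)) \<partial>N) = (\<integral>\<^sup>+ x. ennreal (d x) * ennreal (- ln (d x)) \<partial>M)"
    unfolding eq by (rule nn_integral_density) simp_all
  also have "\<dots> \<le> (\<integral>\<^sup>+ x. 1 \<partial>M)"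
  proof (rule nn_integral_mono)
    fix x
    show "ennreal (d x) * ennreal (- ln (d x)) \<le> 1"
    proof (cases "0 < d x")
      case True
      have "ln (1 / d x) \<le> 1 / d x - 1" using True by (intro ln_le_minus_one) simp
      then have "- ln (d x) \<le> 1 / d x" using True by (simp add: ln_div)
      then have "d x * (- ln (d x)) \<le> 1" using True by (simp add: field_simps)
      then show ?thesis using True by (simp add: ennreal_mult'[symmetric])
    qed (simp add: ennreal_neg)
  qed
  finally show "(\<integral>\<^sup>+ x. ennreal (- ln (d x)) \<partial>N) \<le> 1"
    by (simp add: M.emeasure_space_1)
qed

text \<open>Finiteness upgrades the quasi-integral to a Lebesgue integral, so that linearity and
  domination become available.\<close>

lemma kullback_density_integrable:
  fixes d :: "'a \<Rightarrow> real"
  assumes M: "prob_space M" and N: "prob_space N"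
    and d[measurable]: "d \<in> borel_measurable M"
    and eq: "N = density M (\<lambda>x. ennreal (d x))"
    and fin: "kullback N M \<noteq> \<infinity>"
  shows "integrable N (\<lambda>x. ln (d x))"
    and "kullback N M = ereal (\<integral>x. ln (d x) \<partial>N)"
proof -
  note facts = density_log_facts[OF M N d eq]
  have [measurable]: "d \<in> borel_measurable N" by (simp add: eq)
  show int: "integrable N (\<lambda>x. ln (d x))"
    using facts(3) fin[unfolded facts(2)]
    by (intro integrable_if_ereal_integral_finite) (auto simp: top_unique)
  show "kullback N M = ereal (\<integral>x. ln (d x) \<partial>N)"
    unfolding facts(2) by (rule ereal_integral_eq_integral[OF int])
qed

lemma kullback_finite_density:
  assumes M: "prob_space M" and N: "prob_space N" and sets: "sets N = sets M"
    and fin: "kullback N M \<noteq> \<infinity>"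
  obtains d :: "'a \<Rightarrow> real" where "d \<in> borel_measurable M" "\<And>x. 0 \<le> d x"
    "N = density M (\<lambda>x. ennreal (d x))"
proof -
  interpret M: prob_space M by fact
  interpret N: prob_space N by fact
  have ac: "absolutely_continuous M N"
    using fin by (auto simp: kullback_def split: if_splits)
  obtain D where "D \<in> borel_measurable M" "AE x in M. RN_deriv M N x = ennreal (D x)"
    "AE x in N. 0 < D x" "\<And>x. 0 \<le> D x"
    using M.real_RN_deriv[OF N.finite_measure_axioms ac sets] by blast
  moreover from this have "density M (RN_deriv M N) = density M (\<lambda>x. ennreal (D x))"
    by (intro density_cong) auto
  ultimately show ?thesis
    using that[of D] M.density_RN_deriv[OF ac sets] by metis
qed

text \<open>Compare \<open>N\<close> with the law of density \<open>exp f / w\<close> relative to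
  \<open>M\<close>. The ratio \<open>h\<close> of the two densities has \<open>N\<close>-mass at
  most 1, and integrating \<open>ln h \<le> h - 1\<close> gives the bound. Because \<open>f\<close>
  is nonnegative, the pointwise upper bound also dominates its absolute value, so integrability
  comes along.\<close>

lemma donsker_varadhan:
  fixes f :: "'a \<Rightarrow> real"
  assumes M: "prob_space M" and N: "prob_space N" and sets: "sets N = sets M"
    and K: "kullback N M = ereal K"
    and f[measurable]: "f \<in> borel_measurable M" and f0: "\<And>x. 0 \<le> f x"
    and W: "(\<integral>\<^sup>+ x. ennreal (exp (f x)) \<partial>M) = ennreal w"
  shows "integrable N f" and "(\<integral>x. f x \<partial>N) \<le> K + ln w"
proof -
  interpret M: prob_space M by fact
  interpret N: prob_space N by fact
  obtain d where d[measurable]: "d \<in> borel_measurable M" and d0: "\<And>x. 0 \<le> d x"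
    and eq: "N = density M (\<lambda>x. ennreal (d x))"
    using kullback_finite_density[OF M N sets] K by auto
  have [measurable]: "d \<in> borel_measurable N" "f \<in> borel_measurable N" by (simp_all add: eq)
  have fin: "kullback N M \<noteq> \<infinity>" using K by simp
  note log_int = kullback_density_integrable[OF M N d eq fin]
  have pos: "AE x in N. 0 < d x" by (rule density_log_facts(1)[OF M N d eq])
  \<comment> \<open>Nonnegativity of \<open>f\<close> forces \<open>1 \<le> w\<close>, so
    \<open>ln w\<close> and division by \<open>w\<close> carry their usual meaning.\<close>
  have "(\<integral>\<^sup>+ x. 1 \<partial>M) \<le> (\<integral>\<^sup>+ x. ennreal (exp (f x)) \<partial>M)"
    by (rule nn_integral_mono) (simp add: f0)
  then have "1 \<le> ennreal w" by (simp add: W M.emeasure_space_1)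
  then have w: "1 \<le> w" by (simp add: ennreal_ge_1)
  define h where "h x = exp (f x) / (d x * w)" for x
  have h0: "0 \<le> h x" for x using w d0[of x] by (simp add: h_def)
  have hm[measurable]: "h \<in> borel_measurable N" "h \<in> borel_measurable M"
    unfolding h_def by measurable
  have "(\<integral>\<^sup>+ x. ennreal (h x) \<partial>N) = (\<integral>\<^sup>+ x. ennreal (d x) * ennreal (h x) \<partial>M)"
    unfolding eq by (rule nn_integral_density) simp_all
  also have "\<dots> \<le> (\<integral>\<^sup>+ x. ennreal (exp (f x)) * ennreal (1 / w) \<partial>M)"
  proof (rule nn_integral_mono)
    fix x
    \<comment> \<open>Equality holds where \<open>0 < d x\<close>. Where \<open>d x = 0\<close> the
      left side is 0, which drops the tilted mass lying off the support of \<open>N\<close>.\<close>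
    have "d x * h x \<le> exp (f x) * (1 / w)"
      using w d0[of x] by (cases "d x = 0") (auto simp: h_def)
    then show "ennreal (d x) * ennreal (h x) \<le> ennreal (exp (f x)) * ennreal (1 / w)"
      using d0[of x] w by (simp add: ennreal_mult'[symmetric])
  qed
  also have "\<dots> = ennreal w * ennreal (1 / w)"
    by (subst nn_integral_multc) (simp_all add: W)
  also have "\<dots> = 1" using w by (simp add: ennreal_mult'[symmetric])
  finally have h1: "(\<integral>\<^sup>+ x. ennreal (h x) \<partial>N) \<le> 1" .
  have hint: "integrable N h"
    using h1 h0 by (intro integrableI_nonneg) (auto intro: le_less_trans)
  have hle: "(\<integral>x. h x \<partial>N) \<le> 1"
    using h1 h0 hint by (simp add: nn_integral_eq_integral)
  have bound: "AE x in N. f x \<le> ln (d x) + ln w + h x - 1"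
    using pos
  proof eventually_elim
    case (elim x)
    then have "ln (h x) \<le> h x - 1" using w by (intro ln_le_minus_one) (simp add: h_def)
    moreover have "ln (h x) = f x - (ln (d x) + ln w)"
      using elim w by (simp add: h_def ln_div ln_mult)
    ultimately show ?case by simp
  qed
  have bint: "integrable N (\<lambda>x. ln (d x) + ln w + h x - 1)"
    using log_int(1) hint by simp
  show fint: "integrable N f"
    by (rule Bochner_Integration.integrable_bound[OF bint]) (use bound f0 in \<open>auto\<close>)
  have "(\<integral>x. f x \<partial>N) \<le> (\<integral>x. ln (d x) + ln w + h x - 1 \<partial>N)"
    by (rule integral_mono_AE[OF fint bint bound])
  also have "\<dots> = K + ln w + (\<integral>x. h x \<partial>N) - 1"
    using log_int hint K by (simp add: N.prob_space)
  finally show "(\<integral>x. f x \<partial>N) \<le> K + ln w" using hle by simp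
qed

section \<open>Fubini for quasi-integrals\<close>

text \<open>One-sided control suffices: the negative parts of the sections are bounded uniformly in
  \<theta>, and the upper bound on the iterated quasi-integral then forces the positive part to have
  finite mass as well. Hence \<open>T\<close> is finite almost everywhere and the ordinary Fubini
  theorem applies to its real version.\<close>

lemma fubini_ereal_integral:
  fixes T :: "'a \<times> 'b \<Rightarrow> ereal"
  assumes M: "prob_space M" and N: "prob_space N"
    and T[measurable]: "T \<in> borel_measurable (M \<Otimes>\<^sub>M N)"
    and neg: "\<And>\<theta>. \<theta> \<in> space N \<Longrightarrow> (\<integral>\<^sup>+ y. e2ennreal (- T (y, \<theta>)) \<partial>M) \<le> ennreal c"
    and le: "ereal_integral N (\<lambda>\<theta>. ereal_integral M (\<lambda>y. T (y, \<theta>))) \<le> ereal e"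
  shows "AE z in M \<Otimes>\<^sub>M N. T z = ereal (real_of_ereal (T z))"
    and "integrable (M \<Otimes>\<^sub>M N) (\<lambda>z. real_of_ereal (T z))"
    and "(\<integral>z. real_of_ereal (T z) \<partial>(M \<Otimes>\<^sub>M N)) \<le> e"
proof -
  interpret M: prob_space M by fact
  interpret N: prob_space N by fact
  interpret MN: pair_sigma_finite M N ..
  define u where "u \<theta> = (\<integral>\<^sup>+ y. e2ennreal (T (y, \<theta>)) \<partial>M)" for \<theta>
  define v where "v \<theta> = (\<integral>\<^sup>+ y. e2ennreal (- T (y, \<theta>)) \<partial>M)" for \<theta>
  define g where "g \<theta> = enn2ereal (u \<theta>) - enn2ereal (v \<theta>)" for \<theta>
  have [measurable]: "u \<in> borel_measurable N" "v \<in> borel_measurable N"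
    unfolding u_def v_def by measurable
  have g_eq: "ereal_integral M (\<lambda>y. T (y, \<theta>)) = g \<theta>" for \<theta>
    by (simp add: ereal_integral_def g_def u_def v_def)
  have vc: "v \<theta> \<le> ennreal c" if "\<theta> \<in> space N" for \<theta>
    using neg[OF that] by (simp add: v_def)
  have v_int: "(\<integral>\<^sup>+ \<theta>. v \<theta> \<partial>N) < \<infinity>"
  proof -
    have "(\<integral>\<^sup>+ \<theta>. v \<theta> \<partial>N) \<le> (\<integral>\<^sup>+ \<theta>. ennreal c \<partial>N)"
      by (rule nn_integral_mono) (rule vc)
    also have "\<dots> < \<infinity>" by (simp add: N.emeasure_space_1)
    finally show ?thesis .
  qed
  have g_neg: "e2ennreal (- g \<theta>) \<le> v \<theta>" if "\<theta> \<in> space N" for \<theta>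
    using vc[OF that] unfolding g_def
    by (cases "u \<theta>"; cases "v \<theta>") (auto simp: top_unique e2ennreal_neg intro!: ennreal_leI)
  \<comment> \<open>As \<open>v \<theta>\<close> is finite, \<open>u \<theta>\<close> can be
    recovered from the difference \<open>g \<theta>\<close>; where \<open>u \<theta>\<close> is
    infinite, so is \<open>g \<theta>\<close>.\<close>
  have g_pos: "u \<theta> \<le> e2ennreal (g \<theta>) + v \<theta>" if "\<theta> \<in> space N" for \<theta>
  proof (cases "v \<theta>")
    case v: (real b)
    show ?thesis
    proof (cases "u \<theta>")
      case (real a)
      have "ennreal a \<le> ennreal (max 0 (a - b) + b)" using v by (intro ennreal_leI) simp
      also have "\<dots> = ennreal (a - b) + ennreal b"
        using v by (subst ennreal_plus) (auto simp: max_def ennreal_neg)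
      finally show ?thesis using v real by (simp add: g_def)
    qed (use v in \<open>simp add: g_def\<close>)
  qed (use vc[OF that] in \<open>simp add: top_unique\<close>)
  have "(\<integral>\<^sup>+ \<theta>. e2ennreal (- g \<theta>) \<partial>N) \<le> (\<integral>\<^sup>+ \<theta>. v \<theta> \<partial>N)"
    by (rule nn_integral_mono) (rule g_neg)
  with v_int have "(\<integral>\<^sup>+ \<theta>. e2ennreal (- g \<theta>) \<partial>N) < \<infinity>" by (rule le_less_trans[rotated])
  moreover have "ereal_integral N g \<le> ereal e" using le by (simp add: g_eq)
  ultimately have g_int: "(\<integral>\<^sup>+ \<theta>. e2ennreal (g \<theta>) \<partial>N) < \<infinity>"
    unfolding ereal_integral_def
    by (cases "\<integral>\<^sup>+ \<theta>. e2ennreal (- g \<theta>) \<partial>N"; cases "\<integral>\<^sup>+ \<theta>. e2ennreal (g \<theta>) \<partial>N") auto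
  have [measurable]: "g \<in> borel_measurable N" unfolding g_def by measurable
  have "(\<integral>\<^sup>+ \<theta>. u \<theta> \<partial>N) \<le> (\<integral>\<^sup>+ \<theta>. e2ennreal (g \<theta>) + v \<theta> \<partial>N)"
    by (rule nn_integral_mono) (rule g_pos)
  also have "\<dots> = (\<integral>\<^sup>+ \<theta>. e2ennreal (g \<theta>) \<partial>N) + (\<integral>\<^sup>+ \<theta>. v \<theta> \<partial>N)"
    by (rule nn_integral_add) measurable
  also have "\<dots> < \<infinity>" using g_int v_int by simp
  finally have u_int: "(\<integral>\<^sup>+ \<theta>. u \<theta> \<partial>N) < \<infinity>" .
  have pos: "(\<integral>\<^sup>+ z. e2ennreal (T z) \<partial>(M \<Otimes>\<^sub>M N)) < \<infinity>"
    using u_int unfolding u_def by (subst MN.nn_integral_snd[symmetric]) auto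
  have neg': "(\<integral>\<^sup>+ z. e2ennreal (- T z) \<partial>(M \<Otimes>\<^sub>M N)) < \<infinity>"
    using v_int unfolding v_def by (subst MN.nn_integral_snd[symmetric]) auto
  have "AE z in M \<Otimes>\<^sub>M N. e2ennreal (T z) \<noteq> \<infinity>"
    by (rule nn_integral_noteq_infinite) (use pos in simp_all)
  moreover have "AE z in M \<Otimes>\<^sub>M N. e2ennreal (- T z) \<noteq> \<infinity>"
    by (rule nn_integral_noteq_infinite) (use neg' in simp_all)
  ultimately show ae: "AE z in M \<Otimes>\<^sub>M N. T z = ereal (real_of_ereal (T z))"
  proof eventually_elim
    case (elim z)
    then show ?case by (cases "T z") auto
  qed
  let ?t = "\<lambda>z. real_of_ereal (T z)"
  have "(\<integral>\<^sup>+ z. ennreal (?t z) \<partial>(M \<Otimes>\<^sub>M N)) = (\<integral>\<^sup>+ z. e2ennreal (T z) \<partial>(M \<Otimes>\<^sub>M N))"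
    by (rule nn_integral_cong_AE) (use ae in eventually_elim, metis e2ennreal_ereal)
  moreover have "(\<integral>\<^sup>+ z. ennreal (- ?t z) \<partial>(M \<Otimes>\<^sub>M N)) = (\<integral>\<^sup>+ z. e2ennreal (- T z) \<partial>(M \<Otimes>\<^sub>M N))"
    by (rule nn_integral_cong_AE)
      (use ae in eventually_elim, metis e2ennreal_ereal uminus_ereal.simps(1))
  ultimately show int: "integrable (M \<Otimes>\<^sub>M N) ?t"
    using pos neg' by (simp add: real_integrable_def less_top)
  \<comment> \<open>The exceptional set is read section by section with \<theta> outermost, matching
    the order of the iterated integral.\<close>
  have ae2: "AE \<theta> in N. AE y in M. T (y, \<theta>) = ereal (?t (y, \<theta>))"
    using MN.AE_pair[OF ae] by (subst MN.AE_commute[symmetric]) (simp_all, measurable)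
  have int': "integrable (M \<Otimes>\<^sub>M N) (case_prod (\<lambda>y \<theta>. ?t (y, \<theta>)))"
    using int by (simp add: case_prod_unfold)
  have "ereal_integral N g = ereal_integral N (\<lambda>\<theta>. ereal (\<integral>y. ?t (y, \<theta>) \<partial>M))"
  proof (rule ereal_integral_cong_AE)
    show "AE \<theta> in N. g \<theta> = ereal (\<integral>y. ?t (y, \<theta>) \<partial>M)"
      using ae2 MN.AE_integrable_snd[OF int']
    proof eventually_elim
      case (elim \<theta>)
      have "g \<theta> = ereal_integral M (\<lambda>y. ereal (?t (y, \<theta>)))"
        unfolding g_eq[symmetric] by (rule ereal_integral_cong_AE) (rule elim(1))
      then show ?case using ereal_integral_eq_integral[OF elim(2)] by simp
    qed
  qed
  also have "\<dots> = ereal (\<integral>\<theta>. \<integral>y. ?t (y, \<theta>) \<partial>M \<partial>N)"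
    by (rule ereal_integral_eq_integral) (rule MN.integrable_snd[OF int'])
  also have "\<dots> = ereal (\<integral>z. ?t z \<partial>(M \<Otimes>\<^sub>M N))"
    using MN.integral_snd[OF int'] by (simp add: case_prod_unfold)
  finally show "(\<integral>z. ?t z \<partial>(M \<Otimes>\<^sub>M N)) \<le> e" using le by (simp add: g_eq)
qed

section \<open>Exponentials, log-ratios and affinities with infinite values\<close>

lemma exp_ereal_eq_0_iff [simp]: "exp_ereal x = 0 \<longleftrightarrow> x = -\<infinity>"
  by (cases x) (auto simp: exp_ereal_def)

lemma exp_ereal_ereal [simp]: "exp_ereal (ereal x) = ennreal (exp x)"
  by (simp add: exp_ereal_def)

text \<open>The conventions match in the indeterminate case too: \<infinity> + -\<infinity> is
  \<infinity>, so the left side is 0, and the right side is \<open>0 * \<top> = 0\<close>.\<close>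

lemma exp_ereal_uminus_add:
  "exp_ereal (- (a + b)) = exp_ereal (- a) * exp_ereal (- b)"
  by (cases a; cases b)
    (simp_all add: exp_ereal_def exp_add[symmetric] ennreal_mult'[symmetric]
      ennreal_top_mult ennreal_mult_top)

text \<open>Factorises the tempered likelihood over the observations, in the form that independence
  requires.\<close>

lemma exp_ereal_uminus_sum:
  assumes "0 < \<alpha>"
  shows "exp_ereal (- (ereal \<alpha> * (\<Sum>i\<in>I. f i))) = (\<Prod>i\<in>I. exp_ereal (- (ereal \<alpha> * f i)))"
proof (induction I rule: infinite_finite_induct)
  case (insert i I)
  have "ereal \<alpha> * (f i + (\<Sum>i\<in>I. f i)) = ereal \<alpha> * f i + ereal \<alpha> * (\<Sum>i\<in>I. f i)"
    using assms by (intro ereal_pos_distrib) auto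
  with insert show ?case by (simp add: exp_ereal_uminus_add)
qed (simp_all add: zero_ereal_def)

lemma measurable_exp_ereal [measurable]: "exp_ereal \<in> borel_measurable borel"
  unfolding exp_ereal_def by measurable

lemma measurable_ln_ennreal [measurable]: "ln_ennreal \<in> borel_measurable borel"
  unfolding ln_ennreal_def by measurable

lemma log_ratio_pos:
  assumes "0 < a x" "0 < b x"
  shows "log_ratio a b x = ereal (ln (a x / b x))"
  using assms by (simp add: log_ratio_def ln_ennreal_def divide_ennreal)

lemma log_ratio_zero_denom:
  assumes "0 < a x" "b x = 0"
  shows "log_ratio a b x = \<infinity>"
  using assms by (simp add: log_ratio_def ln_ennreal_def ennreal_divide_zero)

lemma measurable_log_ratio [measurable]:
  assumes [measurable]: "a \<in> borel_measurable M" "b \<in> borel_measurable M"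
  shows "log_ratio a b \<in> borel_measurable M"
  unfolding log_ratio_def[abs_def] by measurable

text \<open>The subtracted term is finite, so the chain rule survives \<open>b x = 0\<close>, where
  both log-ratios are \<infinity>. It changes the reference density from \<open>a\<close> to
  \<open>c\<close>.\<close>

lemma log_ratio_diff:
  assumes "0 < a x" "0 < c x" "0 \<le> b x"
  shows "log_ratio c b x = log_ratio a b x - ereal (ln (a x / c x))"
proof (cases "b x = 0")
  case False
  then have "0 < b x" using assms by simp
  then show ?thesis using assms by (simp add: log_ratio_pos ln_div)
qed (use assms in \<open>simp add: log_ratio_zero_denom\<close>)

text \<open>From \<open>ln t \<le> t - 1\<close> at \<open>t = b / a\<close> one gets
  \<open>a * ln (b / a) \<le> b - a \<le> b\<close>, to be integrated against \<open>Q\<close>. For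
  probability densities the bound is 1, uniformly in \<open>b\<close>.\<close>

lemma nn_integral_log_ratio_neg_le:
  assumes [measurable]: "a \<in> borel_measurable Q" "b \<in> borel_measurable Q"
    and a0: "\<And>x. x \<in> space Q \<Longrightarrow> 0 \<le> a x" and b0: "\<And>x. x \<in> space Q \<Longrightarrow> 0 \<le> b x"
  shows "(\<integral>\<^sup>+ x. e2ennreal (- log_ratio a b x) \<partial>density Q (\<lambda>x. ennreal (a x)))
    \<le> emeasure (density Q (\<lambda>x. ennreal (b x))) (space Q)"
proof -
  have "(\<integral>\<^sup>+ x. e2ennreal (- log_ratio a b x) \<partial>density Q (\<lambda>x. ennreal (a x))) =
      (\<integral>\<^sup>+ x. ennreal (a x) * e2ennreal (- log_ratio a b x) \<partial>Q)"
    by (rule nn_integral_density) measurable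
  also have "\<dots> \<le> (\<integral>\<^sup>+ x. ennreal (b x) \<partial>Q)"
  proof (rule nn_integral_mono)
    fix x assume x: "x \<in> space Q"
    consider "a x = 0" | "0 < a x" "b x = 0" | "0 < a x" "0 < b x"
      using a0[OF x] b0[OF x] by force
    then show "ennreal (a x) * e2ennreal (- log_ratio a b x) \<le> ennreal (b x)"
    proof cases
      case 3
      then have "ln (b x / a x) \<le> b x / a x - 1" by (intro ln_le_minus_one) simp
      then have "a x * ln (b x / a x) \<le> b x - a x" using 3 by (simp add: field_simps)
      then have "a x * (- ln (a x / b x)) \<le> b x" using 3 by (simp add: ln_div)
      then show ?thesis using 3
        by (simp add: log_ratio_pos ennreal_mult'[symmetric] ennreal_leI)
    qed (simp_all add: log_ratio_zero_denom e2ennreal_neg)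
  qed
  also have "\<dots> = emeasure (density Q (\<lambda>x. ennreal (b x))) (space Q)"
    by (subst emeasure_density) (auto intro!: nn_integral_cong)
  finally show ?thesis .
qed

text \<open>Moving the density \<open>a\<close> into the integrand leaves
  \<open>a * (b / a) powr \<alpha>\<close>. Where \<open>b\<close> vanishes but \<open>a\<close>
  does not, the log-ratio is \<infinity> and its exponential 0, in agreement with
  \<open>0 powr \<alpha> = 0\<close>. This identifies the integral in the Renyi divergence as an
  exponential moment of the log-ratio.\<close>

lemma affinity_eq_nn_integral_exp:
  assumes [measurable]: "a \<in> borel_measurable Q" "b \<in> borel_measurable Q"
    and a0: "\<And>x. x \<in> space Q \<Longrightarrow> 0 \<le> a x" and b0: "\<And>x. x \<in> space Q \<Longrightarrow> 0 \<le> b x"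
    and \<alpha>: "0 < \<alpha>" "\<alpha> < 1"
  shows "(\<integral>\<^sup>+ x. exp_ereal (- (ereal \<alpha> * log_ratio a b x)) \<partial>density Q (\<lambda>x. ennreal (a x))) =
    (\<integral>\<^sup>+ x. ennreal (b x powr \<alpha> * a x powr (1 - \<alpha>)) \<partial>Q)"
proof -
  have "(\<integral>\<^sup>+ x. exp_ereal (- (ereal \<alpha> * log_ratio a b x)) \<partial>density Q (\<lambda>x. ennreal (a x))) =
      (\<integral>\<^sup>+ x. ennreal (a x) * exp_ereal (- (ereal \<alpha> * log_ratio a b x)) \<partial>Q)"
    by (rule nn_integral_density) measurable
  also have "\<dots> = (\<integral>\<^sup>+ x. ennreal (b x powr \<alpha> * a x powr (1 - \<alpha>)) \<partial>Q)"
  proof (rule nn_integral_cong)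
    fix x assume x: "x \<in> space Q"
    consider "a x = 0" | "0 < a x" "b x = 0" | "0 < a x" "0 < b x"
      using a0[OF x] b0[OF x] by force
    then show "ennreal (a x) * exp_ereal (- (ereal \<alpha> * log_ratio a b x)) =
      ennreal (b x powr \<alpha> * a x powr (1 - \<alpha>))"
    proof cases
      case 3
      have "exp (- (\<alpha> * ln (a x / b x))) = b x powr \<alpha> * a x powr (- \<alpha>)"
        using 3 by (simp add: powr_def ln_div algebra_simps flip: exp_add)
      moreover have "a x * a x powr (- \<alpha>) = a x powr (1 - \<alpha>)"
        using 3 powr_add[of "a x" 1 "- \<alpha>"] by simp
      ultimately show ?thesis using 3
        by (simp add: log_ratio_pos ennreal_mult'[symmetric] mult.left_commute)
    qed (use \<alpha> in \<open>simp_all add: log_ratio_zero_denom\<close>)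
  qed
  finally show ?thesis .
qed

text \<open>Young's inequality bounds the integrand by the convex combination of the two densities,
  each of total mass 1. It makes the Renyi divergence nonnegative.\<close>

lemma affinity_le_1:
  assumes [measurable]: "a \<in> borel_measurable Q" "b \<in> borel_measurable Q"
    and a0: "\<And>x. x \<in> space Q \<Longrightarrow> 0 \<le> a x" and b0: "\<And>x. x \<in> space Q \<Longrightarrow> 0 \<le> b x"
    and prob: "prob_space (density Q (\<lambda>x. ennreal (a x)))"
      "prob_space (density Q (\<lambda>x. ennreal (b x)))"
    and \<alpha>: "0 < \<alpha>" "\<alpha> < 1"
  shows "(\<integral>\<^sup>+ x. ennreal (b x powr \<alpha> * a x powr (1 - \<alpha>)) \<partial>Q) \<le> 1"
proof -
  have one: "(\<integral>\<^sup>+ x. ennreal (a x) \<partial>Q) = 1" "(\<integral>\<^sup>+ x. ennreal (b x) \<partial>Q) = 1"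
    using prob[THEN prob_space.emeasure_space_1]
    by (auto simp: emeasure_density cong: nn_integral_cong)
  have "(\<integral>\<^sup>+ x. ennreal (b x powr \<alpha> * a x powr (1 - \<alpha>)) \<partial>Q) \<le>
      (\<integral>\<^sup>+ x. ennreal \<alpha> * ennreal (b x) + ennreal (1 - \<alpha>) * ennreal (a x) \<partial>Q)"
  proof (rule nn_integral_mono)
    fix x assume x: "x \<in> space Q"
    have "b x powr \<alpha> * a x powr (1 - \<alpha>) \<le> \<alpha> * b x + (1 - \<alpha>) * a x"
    proof (cases "a x = 0 \<or> b x = 0")
      case False
      then show ?thesis using \<alpha> a0[OF x] b0[OF x] by (intro Youngs_inequality_0) auto
    qed (use \<alpha> a0[OF x] b0[OF x] in auto)
    then have "ennreal (b x powr \<alpha> * a x powr (1 - \<alpha>)) \<le> ennreal (\<alpha> * b x + (1 - \<alpha>) * a x)"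
      by (rule ennreal_leI)
    also have "\<dots> = ennreal \<alpha> * ennreal (b x) + ennreal (1 - \<alpha>) * ennreal (a x)"
      using \<alpha> a0[OF x] b0[OF x] by (simp add: ennreal_mult ennreal_plus)
    finally show "ennreal (b x powr \<alpha> * a x powr (1 - \<alpha>)) \<le>
      ennreal \<alpha> * ennreal (b x) + ennreal (1 - \<alpha>) * ennreal (a x)" .
  qed
  also have "\<dots> = ennreal \<alpha> + ennreal (1 - \<alpha>)"
    by (simp add: nn_integral_add nn_integral_cmult one)
  also have "\<dots> = 1" using \<alpha> by (simp flip: ennreal_plus)
  finally show ?thesis .
qed

section \<open>The variational approximation at a fixed sample\<close>

text \<open>In the application \<open>B \<theta>\<close> is the affinity to the power
  \<open>-n\<close>, and \<open>R\<close> is a finite version of \<open>r\<close> along \<rho>.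
  Donsker-Varadhan relative to the posterior bounds the integral of \<open>ln B\<close> through the
  divergence of \<tau>, minimality replaces \<tau> by \<rho>, and the logarithm of the normalising
  constant occurs with opposite signs and cancels.\<close>

lemma variational_approx_bound:
  fixes r :: "'t \<Rightarrow> ereal" and R :: "'t \<Rightarrow> real" and B :: "'t \<Rightarrow> ennreal"
  assumes \<pi>: "\<pi> \<in> space (prob_algebra \<Theta>)"
    and F: "F \<subseteq> space (prob_algebra \<Theta>)" and \<rho>: "\<rho> \<in> F"
    and \<tau>: "is_variational_approx F \<alpha> \<pi> r \<tau>"
    and r[measurable]: "r \<in> borel_measurable \<Theta>"
    and R: "integrable \<rho> R" "AE \<theta> in \<rho>. r \<theta> = ereal (R \<theta>)"
    and k: "kullback \<rho> \<pi> = ereal k"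
    and B[measurable]: "B \<in> borel_measurable \<Theta>" and B1: "\<And>\<theta>. 1 \<le> B \<theta>"
    and W: "(\<integral>\<^sup>+ \<theta>. B \<theta> * exp_ereal (- (ereal \<alpha> * r \<theta>)) \<partial>\<pi>) = ennreal w"
    and \<alpha>: "0 < \<alpha>" and w0: "0 \<le> w"
  shows "AE \<theta> in \<tau>. B \<theta> < \<infinity>"
    and "integrable \<tau> (\<lambda>\<theta>. ln (enn2real (B \<theta>)))"
    and "(\<integral>\<theta>. ln (enn2real (B \<theta>)) \<partial>\<tau>) \<le> \<alpha> * (\<integral>\<theta>. R \<theta> \<partial>\<rho>) + k + w - 1"
proof -
  have \<tau>F: "\<tau> \<in> F" using \<tau> by (simp add: is_variational_approx_def is_arg_min_def)
  have sets[measurable_cong]: "sets \<pi> = sets \<Theta>" "sets \<rho> = sets \<Theta>" "sets \<tau> = sets \<Theta>"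
    and probs: "prob_space \<pi>" "prob_space \<rho>" "prob_space \<tau>"
    using \<pi> \<rho> \<tau>F F by (auto simp: space_prob_algebra)
  interpret \<pi>: prob_space \<pi> by fact
  interpret \<rho>: prob_space \<rho> by fact
  interpret \<tau>: prob_space \<tau> by fact
  define E where "E \<theta> = exp_ereal (- (ereal \<alpha> * r \<theta>))" for \<theta>
  have E[measurable]: "E \<in> borel_measurable \<Theta>" unfolding E_def by measurable
  obtain d where d[measurable]: "d \<in> borel_measurable \<pi>" and d0: "\<And>x. 0 \<le> d x"
    and \<rho>_eq: "\<rho> = density \<pi> (\<lambda>x. ennreal (d x))"
    using kullback_finite_density[OF probs(1,2)] k sets by auto
  have \<rho>_fin: "kullback \<rho> \<pi> \<noteq> \<infinity>" using k by simp
  note d_int = kullback_density_integrable[OF probs(1,2) d \<rho>_eq \<rho>_fin]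
  have d_pos: "AE \<theta> in \<rho>. 0 < d \<theta>" by (rule density_log_facts(1)[OF probs(1,2) d \<rho>_eq])
  have R_ae: "AE \<theta> in \<pi>. 0 < d \<theta> \<longrightarrow> r \<theta> = ereal (R \<theta>)"
    using R(2) unfolding \<rho>_eq by (subst (asm) AE_density) auto
  define Z where "Z = (\<integral>\<^sup>+ \<theta>. E \<theta> \<partial>\<pi>)"
  \<comment> \<open>Since \<open>1 \<le> B\<close>, the weighted mass \<open>w\<close> also bounds
    the normalising constant, which is therefore finite.\<close>
  have "Z \<le> (\<integral>\<^sup>+ \<theta>. B \<theta> * E \<theta> \<partial>\<pi>)"
    unfolding Z_def using B1 by (intro nn_integral_mono) (metis mult_right_mono mult_1 zero_le)
  then have Zw: "Z \<le> ennreal w" using W by (simp add: E_def)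
  \<comment> \<open>If \<open>Z\<close> were 0, \<open>r\<close> would be \<infinity> almost
    everywhere under \<pi>. It is finite where \<open>d\<close> is positive, and \<rho> lives
    there.\<close>
  have "Z \<noteq> 0"
  proof
    assume "Z = 0"
    then have "AE \<theta> in \<pi>. E \<theta> = 0" unfolding Z_def by (subst (asm) nn_integral_0_iff_AE) auto
    with R_ae have "AE \<theta> in \<pi>. \<not> 0 < d \<theta>"
      by eventually_elim (auto simp: E_def)
    then have "AE \<theta> in \<rho>. \<not> 0 < d \<theta>"
      unfolding \<rho>_eq by (subst AE_density) auto
    with d_pos have "AE \<theta> in \<rho>. False" by eventually_elim simp
    then show False by (simp add: \<rho>.AE_const)
  qed
  with Zw obtain z where z: "Z = ennreal z" "0 < z"
    by (cases Z) (auto simp: top_unique)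
  have zw: "z \<le> w" using Zw z w0 by simp
  define M where "M = density \<pi> (\<lambda>\<theta>. E \<theta> / Z)"
  have M_eq: "M = tempered_posterior \<alpha> \<pi> r"
    by (simp add: M_def tempered_posterior_def E_def Z_def)
  have setsM[measurable_cong]: "sets M = sets \<Theta>" by (simp add: M_def sets)
  have nn_M: "(\<integral>\<^sup>+ \<theta>. g \<theta> \<partial>M) = (\<integral>\<^sup>+ \<theta>. g \<theta> * E \<theta> \<partial>\<pi>) / Z"
    if [measurable]: "g \<in> borel_measurable \<Theta>" for g
    unfolding M_def by (subst nn_integral_density)
      (auto simp: nn_integral_divide[symmetric] ennreal_times_divide mult.commute)
  have "emeasure M (space M) = 1"
    using nn_M[of "\<lambda>_. 1"] z by (simp add: Z_def[symmetric] divide_ennreal)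
  then have M: "prob_space M" by (rule prob_spaceI)
  have E_fin: "AE \<theta> in \<pi>. E \<theta> \<noteq> \<infinity>"
    using z by (intro nn_integral_noteq_infinite) (simp_all add: Z_def[symmetric])
  \<comment> \<open>The density of \<rho> relative to the posterior: \<open>d\<close> divided by the
    posterior density \<open>E / Z\<close>. An infinite \<open>r\<close> is sent to 0 by
    \<open>real_of_ereal\<close>, which is harmless because almost everywhere it occurs only where
    \<open>d\<close> vanishes.\<close>
  define D where "D \<theta> = d \<theta> * (exp (\<alpha> * real_of_ereal (r \<theta>)) * z)" for \<theta>
  have [measurable]: "d \<in> borel_measurable \<Theta>" using d by simp
  have D[measurable]: "D \<in> borel_measurable M" unfolding D_def by measurable
  have D_ae: "AE \<theta> in \<pi>. E \<theta> / Z * ennreal (D \<theta>) = ennreal (d \<theta>)"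
    using R_ae E_fin
  proof eventually_elim
    case (elim \<theta>)
    show ?case
    proof (cases "d \<theta> = 0")
      case False
      then have "0 < d \<theta>" using d0[of \<theta>] by simp
      with elim have "r \<theta> = ereal (R \<theta>)" by simp
      then show ?thesis using z d0[of \<theta>]
        by (simp add: E_def D_def divide_ennreal ennreal_mult'[symmetric] exp_minus field_simps)
    qed (simp add: D_def)
  qed
  have "density M (\<lambda>\<theta>. ennreal (D \<theta>)) = density \<pi> (\<lambda>\<theta>. E \<theta> / Z * ennreal (D \<theta>))"
    unfolding M_def by (rule density_density_eq) measurable
  also have "\<dots> = \<rho>"
    unfolding \<rho>_eq by (rule density_cong) (use D_ae in simp_all)
  finally have \<rho>_M: "\<rho> = density M (\<lambda>\<theta>. ennreal (D \<theta>))" by simp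
  have "kullback \<rho> M = ereal_integral \<rho> (\<lambda>\<theta>. ereal (ln (D \<theta>)))"
    by (rule density_log_facts(2)[OF M probs(2) D \<rho>_M])
  also have "\<dots> = ereal_integral \<rho> (\<lambda>\<theta>. ereal (ln (d \<theta>) + \<alpha> * R \<theta> + ln z))"
  proof (rule ereal_integral_cong_AE)
    show "AE \<theta> in \<rho>. ereal (ln (D \<theta>)) = ereal (ln (d \<theta>) + \<alpha> * R \<theta> + ln z)"
      using d_pos R(2) by eventually_elim (use z in \<open>simp add: D_def ln_mult\<close>)
  qed
  also have "\<dots> = ereal (\<integral>\<theta>. ln (d \<theta>) + \<alpha> * R \<theta> + ln z \<partial>\<rho>)"
    using d_int R(1) by (intro ereal_integral_eq_integral) simp
  also have "\<dots> = ereal (k + \<alpha> * (\<integral>\<theta>. R \<theta> \<partial>\<rho>) + ln z)"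
    using d_int R(1) k by (simp add: \<rho>.prob_space)
  finally have K_\<rho>: "kullback \<rho> M = ereal (k + \<alpha> * (\<integral>\<theta>. R \<theta> \<partial>\<rho>) + ln z)" .
  have K_le: "kullback \<tau> M \<le> kullback \<rho> M"
    using \<tau> \<rho> by (auto simp: is_variational_approx_def is_arg_min_def M_eq not_less)
  then have \<tau>_fin: "kullback \<tau> M \<noteq> \<infinity>" using K_\<rho> by auto
  obtain D' where D': "D' \<in> borel_measurable M" "\<tau> = density M (\<lambda>x. ennreal (D' x))"
    using kullback_finite_density[OF M probs(3) _ \<tau>_fin] sets setsM by auto
  obtain K where K: "kullback \<tau> M = ereal K"
    using kullback_density_integrable(2)[OF M probs(3) D' \<tau>_fin] by blast
  have ac: "absolutely_continuous M \<tau>"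
    using \<tau>_fin by (auto simp: kullback_def split: if_splits)
  \<comment> \<open>This finite mean makes \<open>B\<close> finite almost everywhere under the
    posterior, hence under \<tau>, and is the exponential moment for Donsker-Varadhan.\<close>
  have BM: "(\<integral>\<^sup>+ \<theta>. B \<theta> \<partial>M) = ennreal (w / z)"
    using nn_M[OF B] W z w0 by (simp add: E_def divide_ennreal)
  have B_fin: "AE \<theta> in M. B \<theta> \<noteq> \<infinity>"
    by (intro nn_integral_noteq_infinite) (simp_all add: BM)
  then have "AE \<theta> in \<tau>. B \<theta> \<noteq> \<infinity>"
    by (intro absolutely_continuous_AE[OF _ ac]) (simp_all add: sets setsM)
  then show "AE \<theta> in \<tau>. B \<theta> < \<infinity>" by eventually_elim (simp add: less_top)
  have exp_eq: "(\<integral>\<^sup>+ \<theta>. ennreal (exp (ln (enn2real (B \<theta>)))) \<partial>M) = ennreal (w / z)"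
    unfolding BM[symmetric]
  proof (rule nn_integral_cong_AE)
    show "AE \<theta> in M. ennreal (exp (ln (enn2real (B \<theta>)))) = B \<theta>"
      using B_fin
    proof eventually_elim
      case (elim \<theta>)
      then show ?case using B1[of \<theta>] by (cases "B \<theta>") (auto simp: ennreal_ge_1)
    qed
  qed
  \<comment> \<open>At \<open>B \<theta> = \<top>\<close> the value is the default
    \<open>ln 0 = 0\<close>, so the bound holds everywhere.\<close>
  have ln0: "0 \<le> ln (enn2real (B \<theta>))" for \<theta>
    using B1[of \<theta>] by (cases "B \<theta>") (auto simp: ennreal_ge_1)
  note dv = donsker_varadhan[OF M probs(3) _ K _ ln0 exp_eq]
  show "integrable \<tau> (\<lambda>\<theta>. ln (enn2real (B \<theta>)))"
    by (rule dv(1)) (simp add: sets setsM, measurable)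
  have "(\<integral>\<theta>. ln (enn2real (B \<theta>)) \<partial>\<tau>) \<le> K + ln (w / z)"
    by (rule dv(2)) (simp add: sets setsM, measurable)
  moreover have "ln (w / z) = ln w - ln z" using z zw by (simp add: ln_div)
  \<comment> \<open>Trades the logarithm for a quantity that is linear in \<open>w\<close>, whose
    expectation is controlled later.\<close>
  moreover have "ln w \<le> w - 1" using z zw by (intro ln_le_minus_one) simp
  moreover have "K \<le> k + \<alpha> * (\<integral>\<theta>. R \<theta> \<partial>\<rho>) + ln z" using K_le K K_\<rho> by simp
  ultimately show "(\<integral>\<theta>. ln (enn2real (B \<theta>)) \<partial>\<tau>) \<le> \<alpha> * (\<integral>\<theta>. R \<theta> \<partial>\<rho>) + k + w - 1"
    by simp
qed

section \<open>From the sample to a single observation\<close>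

lemma sum_constant_ereal: "(\<Sum>j\<in>{1..n}. c) = ereal (real n) * c"
proof (induction n)
  case (Suc n)
  then show ?case by (cases c) (auto simp: algebra_simps)
qed simp

text \<open>The sample of \<open>n\<close> equal observations recovers the single log-ratio, up to the factor \<open>n\<close>.\<close>

lemma measurable_log_ratio_if_neg_log_lr:
  fixes p :: "'t \<Rightarrow> 's \<Rightarrow> real"
  assumes n: "1 \<le> n"
    and r: "(\<lambda>(x, \<theta>). neg_log_lr n (p \<theta>) p0 x) \<in> borel_measurable (Pi\<^sub>M {1..n} (\<lambda>_. M) \<Otimes>\<^sub>M \<Theta>)"
  shows "(\<lambda>(y, \<theta>). log_ratio p0 (p \<theta>) y) \<in> borel_measurable (M \<Otimes>\<^sub>M \<Theta>)"
proof -
  have diag: "(\<lambda>(y, \<theta>). (\<lambda>i\<in>{1..n}. y, \<theta>)) \<in> M \<Otimes>\<^sub>M \<Theta> \<rightarrow>\<^sub>M Pi\<^sub>M {1..n} (\<lambda>_. M) \<Otimes>\<^sub>M \<Theta>"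
    by measurable
  have "log_ratio p0 (p \<theta>) y = neg_log_lr n (p \<theta>) p0 (\<lambda>i\<in>{1..n}. y) * ereal (1 / real n)" for y \<theta>
  proof -
    have "neg_log_lr n (p \<theta>) p0 (\<lambda>i\<in>{1..n}. y) = ereal (real n) * log_ratio p0 (p \<theta>) y"
      unfolding neg_log_lr_def sum_constant_ereal[symmetric] by (rule sum.cong) simp_all
    then show ?thesis using n
      by (cases "log_ratio p0 (p \<theta>) y") auto
  qed
  then have "(\<lambda>(y, \<theta>). log_ratio p0 (p \<theta>) y) =
      (\<lambda>z. (\<lambda>(x, \<theta>). neg_log_lr n (p \<theta>) p0 x) ((\<lambda>(y, \<theta>). (\<lambda>i\<in>{1..n}. y, \<theta>)) z) * ereal (1 / real n))"
    by (auto simp: fun_eq_iff)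
  moreover have "\<dots> \<in> borel_measurable (M \<Otimes>\<^sub>M \<Theta>)"
    by (intro borel_measurable_ereal_times measurable_compose[OF diag r]) simp
  ultimately show ?thesis by simp
qed

lemma ereal_integral_PiM_component:
  assumes M: "prob_space M" and i: "i \<in> I" and f[measurable]: "f \<in> borel_measurable M"
  shows "ereal_integral (Pi\<^sub>M I (\<lambda>_. M)) (\<lambda>x. f (x i)) = ereal_integral M f"
proof -
  have c[measurable]: "(\<lambda>x. x i) \<in> Pi\<^sub>M I (\<lambda>_. M) \<rightarrow>\<^sub>M M"
    using i by (rule measurable_component_singleton)
  have "ereal_integral M f = ereal_integral (distr (Pi\<^sub>M I (\<lambda>_. M)) M (\<lambda>x. x i)) f"
    using distr_PiM_component[of I "\<lambda>_. M" i] M i by simp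
  also have "\<dots> = ereal_integral (Pi\<^sub>M I (\<lambda>_. M)) (\<lambda>x. f (x i))"
    unfolding ereal_integral_def by (simp add: nn_integral_distr)
  finally show ?thesis by simp
qed

theorem theorem2p7:
  fixes Q :: "'s measure" and \<Theta> :: "'t measure"
    and P :: "'t \<Rightarrow> 's measure" and p :: "'t \<Rightarrow> 's \<Rightarrow> real"
    and P0 :: "'s measure" and p0 :: "'s \<Rightarrow> real"
    and n i :: nat and \<alpha> \<epsilon> :: real
    and \<pi> \<rho> :: "'t measure" and F :: "'t measure set" and \<theta>s :: 't
    and \<pi>t :: "(nat \<Rightarrow> 's) \<Rightarrow> 't measure"
  defines "\<P> \<equiv> Pi\<^sub>M {1..n} (\<lambda>_. P0)"
  defines "r \<equiv> \<lambda>x \<theta>. neg_log_lr n (p \<theta>) p0 x"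
  assumes P: "\<And>\<theta>. \<theta> \<in> space \<Theta> \<Longrightarrow> prob_space (P \<theta>)"
    and p: "\<And>\<theta>. \<theta> \<in> space \<Theta> \<Longrightarrow> p \<theta> \<in> borel_measurable Q"
      "\<And>\<theta> x. \<theta> \<in> space \<Theta> \<Longrightarrow> x \<in> space Q \<Longrightarrow> 0 \<le> p \<theta> x"
      "\<And>\<theta>. \<theta> \<in> space \<Theta> \<Longrightarrow> P \<theta> = density Q (\<lambda>x. ennreal (p \<theta> x))"
    and P0: "prob_space P0"
    and p0: "p0 \<in> borel_measurable Q" "\<And>x. x \<in> space Q \<Longrightarrow> 0 \<le> p0 x"
      "P0 = density Q (\<lambda>x. ennreal (p0 x))"
    and r_meas: "(\<lambda>(x, \<theta>). r x \<theta>) \<in> borel_measurable (\<P> \<Otimes>\<^sub>M \<Theta>)"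
    and n: "1 \<le> n" and i: "i \<in> {1..n}"
    and prior: "\<pi> \<in> space (prob_algebra \<Theta>)"
    and F: "F \<subseteq> space (prob_algebra \<Theta>)"
    and \<theta>s: "is_arg_min (\<lambda>\<theta>. kullback P0 (P \<theta>)) (\<lambda>\<theta>. \<theta> \<in> space \<Theta>) \<theta>s"
    and \<epsilon>: "0 < \<epsilon>" and \<rho>: "\<rho> \<in> F"
    and \<rho>_bound: "ereal_integral \<rho> (\<lambda>\<theta>. ereal_integral \<P> (\<lambda>x. log_ratio (p \<theta>s) (p \<theta>) (x i))) \<le> ereal \<epsilon>"
    and \<rho>_kullback: "kullback \<rho> \<pi> \<le> ereal (real n * \<epsilon>)"
    and \<alpha>: "0 < \<alpha>" "\<alpha> < 1"
    and \<pi>t: "AE x in \<P>. is_variational_approx F \<alpha> \<pi> (r x) (\<pi>t x)"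
    and \<pi>t_meas: "(\<lambda>x. ereal_integral (\<pi>t x) (\<lambda>\<theta>. renyi_divergence Q \<alpha> (P \<theta>) P0)) \<in> borel_measurable \<P>"
  shows "ereal_integral \<P> (\<lambda>x. ereal_integral (\<pi>t x) (\<lambda>\<theta>. renyi_divergence Q \<alpha> (P \<theta>) P0))
    \<le> ereal (\<alpha> / (1 - \<alpha>)) * (INF \<theta>\<in>space \<Theta>. kullback P0 (P \<theta>)) + ereal ((1 + \<alpha>) / (1 - \<alpha>) * \<epsilon>)"
proof -
  have \<theta>s_in: "\<theta>s \<in> space \<Theta>" using \<theta>s by (simp add: is_arg_min_def)
  have inf_eq: "(INF \<theta>\<in>space \<Theta>. kullback P0 (P \<theta>)) = kullback P0 (P \<theta>s)"
    using \<theta>s by (intro antisym INF_lower INF_greatest) (auto simp: is_arg_min_def not_less)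
  show ?thesis
  proof (cases "kullback P0 (P \<theta>s) = \<infinity>")
    \<comment> \<open>The coefficient \<open>\<alpha> / (1 - \<alpha>)\<close> is positive, so the
      right-hand side is \<infinity>.\<close>
    case True
    then show ?thesis using \<alpha> by (simp add: inf_eq)
  next
    case False

    \<comment> \<open>Probability structure and measurability\<close>
    have \<rho>_prob: "prob_space \<rho>" "sets \<rho> = sets \<Theta>" and \<pi>_prob: "prob_space \<pi>" "sets \<pi> = sets \<Theta>"
      using \<rho> F prior by (auto simp: space_prob_algebra)
    note [measurable_cong] = \<rho>_prob(2) \<pi>_prob(2)
    have space_\<rho>: "space \<rho> = space \<Theta>" and space_\<pi>: "space \<pi> = space \<Theta>"
      using \<rho>_prob \<pi>_prob by (auto dest: sets_eq_imp_space_eq)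
    have sets_P0[measurable_cong]: "sets P0 = sets Q" by (simp add: p0(3))
    have space_P0: "space P0 = space Q" by (simp add: p0(3))
    interpret P0: prob_space P0 by (rule P0)
    interpret \<rho>: prob_space \<rho> by (rule \<rho>_prob)
    interpret \<pi>: prob_space \<pi> by (rule \<pi>_prob)
    interpret P0\<rho>: pair_prob_space P0 \<rho> ..
    interpret PP: prob_space \<P> unfolding \<P>_def by (rule prob_space_PiM) (rule P0)
    interpret PP\<pi>: pair_prob_space \<P> \<pi> ..
    interpret S: product_sigma_finite "\<lambda>_::nat. P0" ..
    have comp[measurable]: "(\<lambda>x. x j) \<in> \<P> \<rightarrow>\<^sub>M P0" if "j \<in> {1..n}" for j
      unfolding \<P>_def using that by (rule measurable_component_singleton)
    have comp_distr: "distr \<P> P0 (\<lambda>x. x j) = P0" if "j \<in> {1..n}" for j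
      unfolding \<P>_def using distr_PiM_component[of "{1..n}" "\<lambda>_. P0" j] that P0 by simp
    have p_meas[measurable]: "p \<theta> \<in> borel_measurable P0" if "\<theta> \<in> space \<Theta>" for \<theta>
      using p(1)[OF that] by simp
    have p0_meas[measurable]: "p0 \<in> borel_measurable P0" using p0(1) by simp
    have p0_pos: "AE y in P0. 0 < p0 y"
      unfolding p0(3) using p0(1) by (subst AE_density) (auto simp: ennreal_neg intro!: AE_I2)

    \<comment> \<open>The log-ratio of a single observation\<close>
    let ?l = "\<lambda>(y, \<theta>). log_ratio p0 (p \<theta>) y"
    have l_meas[measurable]: "?l \<in> borel_measurable (P0 \<Otimes>\<^sub>M \<Theta>)"
      using n r_meas unfolding r_def \<P>_def by (rule measurable_log_ratio_if_neg_log_lr)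
    have r_eq: "r x \<theta> = (\<Sum>j\<in>{1..n}. ?l (x j, \<theta>))" for x \<theta>
      by (simp add: r_def neg_log_lr_def)
    have l_neg: "(\<integral>\<^sup>+ y. e2ennreal (- ?l (y, \<theta>)) \<partial>P0) \<le> 1" if "\<theta> \<in> space \<Theta>" for \<theta>
      using nn_integral_log_ratio_neg_le[OF p0(1) p(1)[OF that] p0(2) p(2)[OF that]]
        prob_space.emeasure_space_1[OF P[OF that]] p(3)[OF that] p0(3) by simp

    \<comment> \<open>Finite divergences and the density of \<open>P0\<close> relative to
      \<open>P \<theta>s\<close>\<close>
    define d where "d y = p0 y / p \<theta>s y" for y
    have d[measurable]: "d \<in> borel_measurable (P \<theta>s)" "d \<in> borel_measurable P0"
      unfolding d_def using p(1)[OF \<theta>s_in] p0(1) by (simp_all add: p(3)[OF \<theta>s_in] p0(3))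
    \<comment> \<open>Finite divergence gives absolute continuity, so \<open>p \<theta>s\<close> is
      positive \<open>P0\<close>-almost everywhere and the quotient \<open>d\<close> is a true
      density.\<close>
    have ac: "absolutely_continuous (P \<theta>s) P0"
      using False by (auto simp: kullback_def split: if_splits)
    have "AE y in P \<theta>s. 0 < p \<theta>s y"
      unfolding p(3)[OF \<theta>s_in] using p(1)[OF \<theta>s_in]
      by (subst AE_density) (auto simp: ennreal_neg intro!: AE_I2)
    then have ps_pos: "AE y in P0. 0 < p \<theta>s y"
      by (intro absolutely_continuous_AE[OF _ ac]) (simp_all add: p(3)[OF \<theta>s_in] p0(3))
    then have ps_Q: "AE y in Q. 0 < p0 y \<longrightarrow> 0 < p \<theta>s y"
      using p0(1) unfolding p0(3) by (subst (asm) AE_density) auto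
    have "density (P \<theta>s) (\<lambda>y. ennreal (d y)) = density Q (\<lambda>y. ennreal (p \<theta>s y) * ennreal (d y))"
      unfolding p(3)[OF \<theta>s_in]
      using p(1)[OF \<theta>s_in] p0(1) by (intro density_density_eq) (simp_all add: d_def[abs_def])
    also have "\<dots> = P0"
      unfolding p0(3)
    proof (rule density_cong)
      show "AE y in Q. ennreal (p \<theta>s y) * ennreal (d y) = ennreal (p0 y)"
        using ps_Q AE_space
      proof eventually_elim
        case (elim y)
        then show ?case using p0(2)[of y]
          by (cases "p0 y = 0") (auto simp: d_def ennreal_mult'[symmetric])
      qed
    qed (use p(1)[OF \<theta>s_in] p0(1) in \<open>simp_all add: d_def[abs_def]\<close>)
    finally have P0_d: "P0 = density (P \<theta>s) (\<lambda>y. ennreal (d y))" by simp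
    note ln_d = kullback_density_integrable[OF P[OF \<theta>s_in] P0 d(1) P0_d False]
    define K where "K = (\<integral>y. ln (d y) \<partial>P0)"
    have K: "kullback P0 (P \<theta>s) = ereal K" using ln_d(2) by (simp add: K_def)
    obtain k where k: "kullback \<rho> \<pi> = ereal k" and k_le: "k \<le> real n * \<epsilon>"
    proof -
      have fin: "kullback \<rho> \<pi> \<noteq> \<infinity>" using \<rho>_kullback by auto
      obtain D where D: "D \<in> borel_measurable \<pi>" "\<rho> = density \<pi> (\<lambda>x. ennreal (D x))"
        using kullback_finite_density[OF \<pi>_prob(1) \<rho>_prob(1) _ fin] \<rho>_prob(2) \<pi>_prob(2) by auto
      show ?thesis
        using that kullback_density_integrable(2)[OF \<pi>_prob(1) \<rho>_prob(1) D fin] \<rho>_kullback by auto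
    qed

    \<comment> \<open>Almost surely the log-ratio of \<open>p \<theta>s\<close> to \<open>p \<theta>\<close>, but jointly measurable by construction.\<close>
    define T where "T z = ?l z - ereal (ln (d (fst z)))" for z

    \<comment> \<open>Joint integrability of \<open>T\<close>\<close>
    have l_meas_\<rho>[measurable]: "?l \<in> borel_measurable (P0 \<Otimes>\<^sub>M \<rho>)"
      using l_meas by (subst measurable_cong_sets[OF sets_pair_measure_cong[OF refl \<rho>_prob(2)] refl])
    have T_meas: "T \<in> borel_measurable (P0 \<Otimes>\<^sub>M \<rho>)" unfolding T_def by measurable
    \<comment> \<open>The 1 bounds the negative part of \<open>?l\<close> for every \<theta>; the
      second term is the most that subtracting \<open>ln d\<close> can add.\<close>
    define c where "c = 1 + (\<integral>y. \<bar>ln (d y)\<bar> \<partial>P0)"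
    have T_neg: "(\<integral>\<^sup>+ y. e2ennreal (- T (y, \<theta>)) \<partial>P0) \<le> ennreal c" if "\<theta> \<in> space \<rho>" for \<theta>
    proof -
      have \<theta>: "\<theta> \<in> space \<Theta>" using that space_\<rho> by simp
      have le: "e2ennreal (- T (y, \<theta>)) \<le> e2ennreal (- ?l (y, \<theta>)) + ennreal \<bar>ln (d y)\<bar>" for y
      proof (cases "?l (y, \<theta>)")
        case (real a)
        have "ennreal (ln (d y) - a) \<le> ennreal (max 0 (- a) + \<bar>ln (d y)\<bar>)"
          by (rule ennreal_leI) simp
        also have "\<dots> = ennreal (- a) + ennreal \<bar>ln (d y)\<bar>"
          by (subst ennreal_plus) (auto simp: max_def ennreal_neg)
        finally show ?thesis using real by (simp add: T_def)
      qed (simp_all add: T_def e2ennreal_neg)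
      have "(\<integral>\<^sup>+ y. e2ennreal (- T (y, \<theta>)) \<partial>P0) \<le>
          (\<integral>\<^sup>+ y. e2ennreal (- ?l (y, \<theta>)) + ennreal \<bar>ln (d y)\<bar> \<partial>P0)"
        by (rule nn_integral_mono) (rule le)
      also have "\<dots> = (\<integral>\<^sup>+ y. e2ennreal (- ?l (y, \<theta>)) \<partial>P0) + (\<integral>\<^sup>+ y. ennreal \<bar>ln (d y)\<bar> \<partial>P0)"
        using \<theta> by (intro nn_integral_add) simp_all
      also have "\<dots> \<le> 1 + ennreal (\<integral>y. \<bar>ln (d y)\<bar> \<partial>P0)"
        using ln_d(1) by (intro add_mono l_neg[OF \<theta>]) (simp add: nn_integral_eq_integral)
      also have "\<dots> = ennreal c"
        unfolding c_def by (subst ennreal_plus) simp_all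
      finally show ?thesis .
    qed
    have T_int: "ereal_integral P0 (\<lambda>y. T (y, \<theta>)) =
        ereal_integral \<P> (\<lambda>x. log_ratio (p \<theta>s) (p \<theta>) (x i))" if "\<theta> \<in> space \<rho>" for \<theta>
    proof -
      have \<theta>: "\<theta> \<in> space \<Theta>" using that space_\<rho> by simp
      have "ereal_integral \<P> (\<lambda>x. log_ratio (p \<theta>s) (p \<theta>) (x i)) =
          ereal_integral P0 (log_ratio (p \<theta>s) (p \<theta>))"
        unfolding \<P>_def using P0 i \<theta> \<theta>s_in by (intro ereal_integral_PiM_component) simp_all
      also have "\<dots> = ereal_integral P0 (\<lambda>y. T (y, \<theta>))"
      proof (rule ereal_integral_cong_AE)
        show "AE y in P0. log_ratio (p \<theta>s) (p \<theta>) y = T (y, \<theta>)"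
          using p0_pos ps_pos AE_space
          by eventually_elim
            (simp add: T_def d_def log_ratio_diff[where a = p0 and c = "p \<theta>s"] p(2) \<theta> space_P0)
      qed
      finally show ?thesis by simp
    qed
    have T_\<epsilon>: "ereal_integral \<rho> (\<lambda>\<theta>. ereal_integral P0 (\<lambda>y. T (y, \<theta>))) \<le> ereal \<epsilon>"
    proof -
      have "ereal_integral \<rho> (\<lambda>\<theta>. ereal_integral P0 (\<lambda>y. T (y, \<theta>))) =
          ereal_integral \<rho> (\<lambda>\<theta>. ereal_integral \<P> (\<lambda>x. log_ratio (p \<theta>s) (p \<theta>) (x i)))"
        by (rule ereal_integral_cong_AE) (auto intro!: AE_I2 T_int)
      then show ?thesis using \<rho>_bound by simp
    qed
    have T_fubini: "AE z in P0 \<Otimes>\<^sub>M \<rho>. T z = ereal (real_of_ereal (T z))"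
      "integrable (P0 \<Otimes>\<^sub>M \<rho>) (\<lambda>z. real_of_ereal (T z))"
      "(\<integral>z. real_of_ereal (T z) \<partial>(P0 \<Otimes>\<^sub>M \<rho>)) \<le> \<epsilon>"
      by (rule fubini_ereal_integral[OF P0 \<rho>_prob(1) T_meas _ T_\<epsilon>], erule T_neg)+

    \<comment> \<open>The log-likelihood ratio averaged over \<rho>\<close>
    \<comment> \<open>Adding \<open>ln d\<close> back turns \<open>T\<close> into a finite version
      of \<open>?l\<close>. Its mean is that of \<open>T\<close>, at most \<epsilon>, plus
      \<open>K\<close>: this is where the minimal divergence enters.\<close>
    define L where "L y \<theta> = real_of_ereal (T (y, \<theta>)) + ln (d y)" for y \<theta>
    have ln_d_pair: "integrable (P0 \<Otimes>\<^sub>M \<rho>) (\<lambda>z. ln (d (fst z)))"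
      "(\<integral>z. ln (d (fst z)) \<partial>(P0 \<Otimes>\<^sub>M \<rho>)) = K"
    proof -
      have fst_distr: "distr (P0 \<Otimes>\<^sub>M \<rho>) P0 fst = P0"
        by (rule \<rho>.distr_pair_fst)
      show "integrable (P0 \<Otimes>\<^sub>M \<rho>) (\<lambda>z. ln (d (fst z)))"
        using ln_d(1) by (intro integrable_distr[of fst _ P0]) (simp_all add: fst_distr)
      show "(\<integral>z. ln (d (fst z)) \<partial>(P0 \<Otimes>\<^sub>M \<rho>)) = K"
        unfolding K_def by (subst (2) fst_distr[symmetric]) (simp add: integral_distr)
    qed
    have L_eq: "case_prod L = (\<lambda>z. real_of_ereal (T z) + ln (d (fst z)))"
      by (auto simp: L_def fun_eq_iff)
    have L_int: "integrable (P0 \<Otimes>\<^sub>M \<rho>) (case_prod L)"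
      using Bochner_Integration.integrable_add[OF T_fubini(2) ln_d_pair(1)]
      by (simp add: L_eq)
    have L_le: "(\<integral>y. \<integral>\<theta>. L y \<theta> \<partial>\<rho> \<partial>P0) \<le> \<epsilon> + K"
    proof -
      have "(\<integral>y. \<integral>\<theta>. L y \<theta> \<partial>\<rho> \<partial>P0) = (\<integral>z. case_prod L z \<partial>(P0 \<Otimes>\<^sub>M \<rho>))"
        by (rule P0\<rho>.integral_fst[OF L_int])
      also have "\<dots> = (\<integral>z. real_of_ereal (T z) \<partial>(P0 \<Otimes>\<^sub>M \<rho>)) + K"
        using Bochner_Integration.integral_add[OF T_fubini(2) ln_d_pair(1)] ln_d_pair(2)
        by (simp add: L_eq)
      finally show ?thesis using T_fubini(3) by simp
    qed
    have L_ae: "AE y in P0. AE \<theta> in \<rho>. ?l (y, \<theta>) = ereal (L y \<theta>)"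
    proof -
      have "AE z in P0 \<Otimes>\<^sub>M \<rho>. ?l z = ereal (L (fst z) (snd z))"
        using T_fubini(1)
      proof eventually_elim
        case (elim z)
        then show ?case by (cases "?l z") (auto simp: T_def L_def)
      qed
      from P0\<rho>.AE_pair[OF this] show ?thesis by simp
    qed
    define H where "H y = (\<integral>\<theta>. L y \<theta> \<partial>\<rho>)" for y
    have H_int: "integrable P0 H" unfolding H_def by (rule P0\<rho>.integrable_fst[OF L_int])
    have good: "AE y in P0. integrable \<rho> (L y) \<and> (AE \<theta> in \<rho>. ?l (y, \<theta>) = ereal (L y \<theta>))"
      using P0\<rho>.AE_integrable_fst[OF L_int] L_ae by eventually_elim simp
    \<comment> \<open>Finitely many coordinates, each of law \<open>P0\<close>, so their null sets
      can be discarded together.\<close>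
    have good_all: "AE x in \<P>. \<forall>j\<in>{1..n}. integrable \<rho> (L (x j)) \<and>
        (AE \<theta> in \<rho>. ?l (x j, \<theta>) = ereal (L (x j) \<theta>))"
      unfolding \<P>_def using good P0
      by (subst AE_finite_all) (auto intro!: AE_PiM_component)
    define R where "R x \<theta> = (\<Sum>j\<in>{1..n}. L (x j) \<theta>)" for x \<theta>
    have R_facts: "AE x in \<P>. integrable \<rho> (R x) \<and> (AE \<theta> in \<rho>. r x \<theta> = ereal (R x \<theta>)) \<and>
        (\<integral>\<theta>. R x \<theta> \<partial>\<rho>) = (\<Sum>j\<in>{1..n}. H (x j))"
      using good_all
    proof eventually_elim
      case (elim x)
      have "AE \<theta> in \<rho>. \<forall>j\<in>{1..n}. ?l (x j, \<theta>) = ereal (L (x j) \<theta>)"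
        using elim by (subst AE_finite_all) auto
      then have "AE \<theta> in \<rho>. r x \<theta> = ereal (R x \<theta>)"
        by eventually_elim (simp add: r_eq R_def)
      then show ?case using elim by (auto simp: R_def[abs_def] H_def)
    qed
    \<comment> \<open>Almost surely the \<rho>-mean of \<open>r x\<close>, written as a sum over
      coordinates so that its expectation is \<open>n\<close> times that of
      \<open>H\<close>.\<close>
    define HH where "HH x = (\<Sum>j\<in>{1..n}. H (x j))" for x
    have HH_int: "integrable \<P> HH" and HH_le: "(\<integral>x. HH x \<partial>\<P>) \<le> real n * (\<epsilon> + K)"
    proof -
      have i1: "integrable \<P> (\<lambda>x. H (x j))" if "j \<in> {1..n}" for j
        using H_int comp_distr[OF that] by (intro integrable_distr[OF comp[OF that]]) simp
      have i2: "(\<integral>x. H (x j) \<partial>\<P>) = (\<integral>y. H y \<partial>P0)" if "j \<in> {1..n}" for j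
        using integral_distr[OF comp[OF that] borel_measurable_integrable[OF H_int]]
        by (simp add: comp_distr[OF that])
      show "integrable \<P> HH" unfolding HH_def by (intro Bochner_Integration.integrable_sum i1)
      have "(\<integral>x. HH x \<partial>\<P>) = (\<Sum>j\<in>{1..n}. (\<integral>y. H y \<partial>P0))"
        unfolding HH_def using i1 i2 by (subst Bochner_Integration.integral_sum) simp_all
      also have "\<dots> = real n * (\<integral>y. H y \<partial>P0)" by simp
      also have "\<dots> \<le> real n * (\<epsilon> + K)"
        using L_le by (intro mult_left_mono) (simp_all add: H_def)
      finally show "(\<integral>x. HH x \<partial>\<P>) \<le> real n * (\<epsilon> + K)" .
    qed

    \<comment> \<open>Affinities, Renyi divergences and the weight \<open>B\<close>\<close>
    define A where "A \<theta> = (\<integral>\<^sup>+ y. exp_ereal (- (ereal \<alpha> * ?l (y, \<theta>))) \<partial>P0)" for \<theta>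
    have A_meas[measurable]: "A \<in> borel_measurable \<Theta>" unfolding A_def by measurable
    have A_eq: "A \<theta> = (\<integral>\<^sup>+ y. ennreal (p \<theta> y powr \<alpha> * p0 y powr (1 - \<alpha>)) \<partial>Q)"
      if "\<theta> \<in> space \<Theta>" for \<theta>
      using affinity_eq_nn_integral_exp[OF p0(1) p(1)[OF that] p0(2) p(2)[OF that] \<alpha>]
      by (simp add: A_def p0(3)[symmetric])
    have A_le: "A \<theta> \<le> 1" if "\<theta> \<in> space \<Theta>" for \<theta>
      using affinity_le_1[OF p0(1) p(1)[OF that] p0(2) p(2)[OF that] _ _ \<alpha>] P0 P[OF that]
      by (simp add: A_eq[OF that] p0(3)[symmetric] p(3)[OF that, symmetric])
    have renyi: "renyi_divergence Q \<alpha> (P \<theta>) P0 = ereal (1 / (\<alpha> - 1)) * ln_ennreal (A \<theta>)"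
      if "\<theta> \<in> space \<Theta>" for \<theta>
      unfolding A_eq[OF that] using that P[OF that] P0
      by (intro renyi_divergence_density p p0) (simp_all add: prob_space.finite_measure)
    \<comment> \<open>The minimum is \<open>A \<theta>\<close> on \<open>space \<Theta>\<close>; it makes \<open>1 \<le> B \<theta>\<close> unconditional.\<close>
    define B where "B \<theta> = inverse (min 1 (A \<theta>)) ^ n" for \<theta>
    have B_meas[measurable]: "B \<in> borel_measurable \<Theta>" unfolding B_def by measurable
    have B1: "1 \<le> B \<theta>" for \<theta>
    proof -
      \<comment> \<open>This includes \<open>x = 0\<close>, whose inverse is \<top>: a vanishing
        affinity gives an infinite weight, just as it gives an infinite Renyi divergence.\<close>
      have "1 \<le> inverse x" if "x \<le> 1" for x :: ennreal
      proof (cases x)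
        case (real a)
        then have "a \<le> 1" using that by (simp add: ennreal_le_1)
        then show ?thesis using real
          by (cases "a = 0") (auto simp: inverse_ennreal ennreal_ge_1 one_le_inverse)
      qed (use that in \<open>simp add: top_unique\<close>)
      then have "1 \<le> inverse (min 1 (A \<theta>))" by simp
      then show ?thesis unfolding B_def by (simp add: one_le_power)
    qed

    \<comment> \<open>The weighted mass \<open>W\<close> and its expectation\<close>
    define W where "W x = (\<integral>\<^sup>+ \<theta>. B \<theta> * exp_ereal (- (ereal \<alpha> * r x \<theta>)) \<partial>\<pi>)" for x
    have r_meas_\<pi>[measurable]: "(\<lambda>(x, \<theta>). r x \<theta>) \<in> borel_measurable (\<P> \<Otimes>\<^sub>M \<pi>)"
      using r_meas by (subst measurable_cong_sets[OF sets_pair_measure_cong[OF refl \<pi>_prob(2)] refl])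
    have W_meas[measurable]: "W \<in> borel_measurable \<P>" unfolding W_def by measurable
    have W_le: "(\<integral>\<^sup>+ x. W x \<partial>\<P>) \<le> 1"
    proof -
      have "(\<integral>\<^sup>+ x. W x \<partial>\<P>) = (\<integral>\<^sup>+ \<theta>. \<integral>\<^sup>+ x. B \<theta> * exp_ereal (- (ereal \<alpha> * r x \<theta>)) \<partial>\<P> \<partial>\<pi>)"
        unfolding W_def by (rule PP\<pi>.Fubini'[symmetric]) measurable
      also have "\<dots> \<le> (\<integral>\<^sup>+ \<theta>. 1 \<partial>\<pi>)"
      proof (rule nn_integral_mono)
        fix \<theta> assume "\<theta> \<in> space \<pi>"
        then have \<theta>: "\<theta> \<in> space \<Theta>" by (simp add: space_\<pi>)
        have [measurable]: "(\<lambda>x. r x \<theta>) \<in> borel_measurable \<P>"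
          using measurable_Pair1[OF r_meas \<theta>] by simp
        \<comment> \<open>By independence the expectation of the product is the product of the
          expectations, namely \<open>A \<theta> ^ n\<close>; the weight \<open>B\<close> is chosen
          to cancel it.\<close>
        have "(\<integral>\<^sup>+ x. exp_ereal (- (ereal \<alpha> * r x \<theta>)) \<partial>\<P>) =
            (\<integral>\<^sup>+ x. (\<Prod>j\<in>{1..n}. exp_ereal (- (ereal \<alpha> * ?l (x j, \<theta>)))) \<partial>\<P>)"
          unfolding r_eq using \<alpha>(1) by (simp add: exp_ereal_uminus_sum)
        also have "\<dots> = (\<Prod>j\<in>{1..n}. A \<theta>)"
          unfolding \<P>_def A_def using \<theta> by (intro S.product_nn_integral_prod) simp_all
        finally have "(\<integral>\<^sup>+ x. B \<theta> * exp_ereal (- (ereal \<alpha> * r x \<theta>)) \<partial>\<P>) = B \<theta> * A \<theta> ^ n"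
          by (simp add: nn_integral_cmult)
        also have "\<dots> = (inverse (A \<theta>) * A \<theta>) ^ n"
          using A_le[OF \<theta>] by (simp add: B_def min_absorb2 power_mult_distrib)
        \<comment> \<open>Only an inequality in general: at \<open>A \<theta> = 0\<close> the
          product \<open>\<top> * 0\<close> is 0 rather than 1.\<close>
        also have "\<dots> \<le> 1"
        proof (cases "A \<theta> = 0")
          case True
          then show ?thesis by (simp add: power_le_one)
        next
          case A0: False
          have "A \<theta> < \<top>" using A_le[OF \<theta>] by (rule le_less_trans) simp
          then have "inverse (A \<theta>) * A \<theta> = 1"
            using A0 ennreal_divide_self[of "A \<theta>"] by (simp add: divide_ennreal_def mult.commute)
          then show ?thesis by simp
        qed
        finally show "(\<integral>\<^sup>+ x. B \<theta> * exp_ereal (- (ereal \<alpha> * r x \<theta>)) \<partial>\<P>) \<le> 1" .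
      qed
      finally show ?thesis by (simp add: \<pi>.emeasure_space_1)
    qed
    define w where "w x = enn2real (W x)" for x
    have W_fin: "AE x in \<P>. W x = ennreal (w x)"
    proof -
      have "AE x in \<P>. W x \<noteq> \<infinity>"
        by (rule nn_integral_noteq_infinite) (use W_le in \<open>auto simp: top_unique\<close>)
      then show ?thesis by eventually_elim (simp add: w_def less_top)
    qed
    have w_nn: "(\<integral>\<^sup>+ x. ennreal (w x) \<partial>\<P>) \<le> 1"
      using W_le nn_integral_cong_AE[OF W_fin] by simp
    have w0: "0 \<le> w x" for x by (simp add: w_def)
    have w_meas: "w \<in> borel_measurable \<P>" unfolding w_def by measurable
    have w_int: "integrable \<P> w"
      using w_nn w0 w_meas by (intro integrableI_nonneg) (auto intro: le_less_trans)
    have w_le: "(\<integral>x. w x \<partial>\<P>) \<le> 1"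
      using w_nn w0 w_int by (simp add: nn_integral_eq_integral)

    \<comment> \<open>The almost sure bound on the Renyi integral\<close>
    define J where "J x = ereal_integral (\<pi>t x) (\<lambda>\<theta>. renyi_divergence Q \<alpha> (P \<theta>) P0)" for x
    \<comment> \<open>The variational bound rescaled: where the affinity is positive,
      \<open>ln B\<close> is \<open>n * (1 - \<alpha>)\<close> times the Renyi divergence.\<close>
    define G where "G x = (\<alpha> * HH x + k + w x - 1) / (real n * (1 - \<alpha>))" for x
    have n\<alpha>: "0 < real n * (1 - \<alpha>)" using n \<alpha> by simp
    have J_bound: "AE x in \<P>. 0 \<le> J x \<and> J x \<le> ereal (G x)"
      using \<pi>t R_facts W_fin AE_space
    proof eventually_elim
      case (elim x)
      have [measurable]: "r x \<in> borel_measurable \<Theta>"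
        using measurable_Pair2[OF r_meas elim(4)] by simp
      have R1: "integrable \<rho> (R x)" and R2: "AE \<theta> in \<rho>. r x \<theta> = ereal (R x \<theta>)"
        and R3: "(\<integral>\<theta>. R x \<theta> \<partial>\<rho>) = HH x"
        using elim(2) by (auto simp: HH_def)
      have Wx: "(\<integral>\<^sup>+ \<theta>. B \<theta> * exp_ereal (- (ereal \<alpha> * r x \<theta>)) \<partial>\<pi>) = ennreal (w x)"
        using elim(3) by (simp add: W_def)
      note bound = variational_approx_bound[OF prior F \<rho> elim(1) _ R1 R2 k B_meas B1 Wx \<alpha>(1) w0]
      have "\<pi>t x \<in> F" using elim(1) by (simp add: is_variational_approx_def is_arg_min_def)
      then have space: "space (\<pi>t x) = space \<Theta>"
        using F by (auto simp: space_prob_algebra dest: sets_eq_imp_space_eq)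
      let ?f = "\<lambda>\<theta>. ln (enn2real (B \<theta>)) / (real n * (1 - \<alpha>))"
      have "J x = ereal_integral (\<pi>t x) (\<lambda>\<theta>. ereal (?f \<theta>))"
        unfolding J_def
      proof (rule ereal_integral_cong_AE)
        have "AE \<theta> in \<pi>t x. B \<theta> < \<infinity>" by (rule bound(1)) simp
        then show "AE \<theta> in \<pi>t x. renyi_divergence Q \<alpha> (P \<theta>) P0 = ereal (?f \<theta>)"
          using AE_space
        proof eventually_elim
          case (elim \<theta>)
          have \<theta>: "\<theta> \<in> space \<Theta>" using elim(2) space by simp
          have B: "B \<theta> = inverse (A \<theta>) ^ n" using A_le[OF \<theta>] by (simp add: B_def min_absorb2)
          \<comment> \<open>A zero affinity would give \<open>B \<theta> = \<top> ^ n\<close>, which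
            is infinite because \<open>n\<close> is positive.\<close>
          have "A \<theta> \<noteq> 0" using elim(1) n by (auto simp: B power_eq_top_ennreal)
          moreover have "A \<theta> < \<top>" using A_le[OF \<theta>] by (rule le_less_trans) simp
          ultimately obtain a where a: "A \<theta> = ennreal a" "0 < a"
            by (cases "A \<theta>") auto
          have "enn2real (B \<theta>) = inverse a ^ n"
            using a by (simp add: B inverse_ennreal ennreal_power)
          then have "?f \<theta> = - ln a / (1 - \<alpha>)"
            using a n \<alpha> by (simp add: ln_realpow ln_inverse)
          also have "\<dots> = 1 / (\<alpha> - 1) * ln a" using \<alpha> by (simp add: field_simps)
          finally show ?case using a by (simp add: renyi[OF \<theta>] ln_ennreal_def)
        qed
      qed
      also have "\<dots> = ereal ((\<integral>\<theta>. ln (enn2real (B \<theta>)) \<partial>\<pi>t x) / (real n * (1 - \<alpha>)))"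
      proof -
        have "integrable (\<pi>t x) (\<lambda>\<theta>. ln (enn2real (B \<theta>)))" by (rule bound(2)) simp
        then show ?thesis by (subst ereal_integral_eq_integral) simp_all
      qed
      finally have J_eq: "J x = ereal ((\<integral>\<theta>. ln (enn2real (B \<theta>)) \<partial>\<pi>t x) / (real n * (1 - \<alpha>)))" .
      have "0 \<le> ln (enn2real (B \<theta>))" for \<theta>
        using B1[of \<theta>] by (cases "B \<theta>") (auto simp: ennreal_ge_1)
      then have "0 \<le> (\<integral>\<theta>. ln (enn2real (B \<theta>)) \<partial>\<pi>t x)" by (intro integral_nonneg_AE) simp
      moreover have "(\<integral>\<theta>. ln (enn2real (B \<theta>)) \<partial>\<pi>t x) \<le> \<alpha> * HH x + k + w x - 1"
        unfolding R3[symmetric] by (rule bound(3)) simp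
      ultimately show ?case
        unfolding J_eq G_def using n\<alpha> by (simp add: divide_right_mono)
    qed

    \<comment> \<open>Taking expectations\<close>
    have G_int: "integrable \<P> G" unfolding G_def using HH_int w_int by simp
    have G_le: "(\<integral>x. G x \<partial>\<P>) \<le> \<alpha> / (1 - \<alpha>) * K + (1 + \<alpha>) / (1 - \<alpha>) * \<epsilon>"
    proof -
      have "(\<integral>x. G x \<partial>\<P>) = (\<alpha> * (\<integral>x. HH x \<partial>\<P>) + k + (\<integral>x. w x \<partial>\<P>) - 1) / (real n * (1 - \<alpha>))"
        unfolding G_def using HH_int w_int by (simp add: PP.prob_space)
      \<comment> \<open>The mean of \<open>w\<close> is at most 1 and is absorbed by the
        \<open>- 1\<close>. The bound on \<open>k\<close> adds \<open>n * \<epsilon>\<close>, which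
        turns the coefficient \<alpha> of \<epsilon> into \<open>1 + \<alpha>\<close>.\<close>
      also have "\<dots> \<le> (\<alpha> * (real n * (\<epsilon> + K)) + real n * \<epsilon>) / (real n * (1 - \<alpha>))"
        using HH_le w_le k_le n\<alpha> mult_left_mono[OF HH_le, of \<alpha>] \<alpha>
        by (intro divide_right_mono) linarith+
      also have "\<dots> = (real n * (\<alpha> * K + (1 + \<alpha>) * \<epsilon>)) / (real n * (1 - \<alpha>))"
        by (simp add: algebra_simps)
      also have "\<dots> = (\<alpha> * K + (1 + \<alpha>) * \<epsilon>) / (1 - \<alpha>)" using n by simp
      also have "\<dots> = \<alpha> / (1 - \<alpha>) * K + (1 + \<alpha>) / (1 - \<alpha>) * \<epsilon>"
        by (metis add_divide_distrib times_divide_eq_left)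
      finally show ?thesis .
    qed
    \<comment> \<open>Nonnegativity inherited from \<open>J\<close> identifies the nonnegative
      integral of \<open>G\<close> with its Lebesgue integral.\<close>
    have G0: "AE x in \<P>. 0 \<le> G x"
      using J_bound by eventually_elim (metis ereal_less_eq(5) order_trans)
    have "ereal_integral \<P> J = enn2ereal (\<integral>\<^sup>+ x. e2ennreal (J x) \<partial>\<P>)"
      using J_bound by (intro ereal_integral_nonneg_eq) auto
    also have "\<dots> \<le> enn2ereal (\<integral>\<^sup>+ x. ennreal (G x) \<partial>\<P>)"
    proof -
      have "(\<integral>\<^sup>+ x. e2ennreal (J x) \<partial>\<P>) \<le> (\<integral>\<^sup>+ x. ennreal (G x) \<partial>\<P>)"
        by (rule nn_integral_mono_AE)
          (use J_bound in eventually_elim, metis e2ennreal_ereal e2ennreal_mono)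
      then show ?thesis by (simp add: less_eq_ennreal.rep_eq)
    qed
    also have "\<dots> = ereal (\<integral>x. G x \<partial>\<P>)"
      using G_int G0 by (simp add: nn_integral_eq_integral integral_nonneg_AE)
    also have "\<dots> \<le> ereal (\<alpha> / (1 - \<alpha>) * K + (1 + \<alpha>) / (1 - \<alpha>) * \<epsilon>)"
      using G_le by simp
    finally show ?thesis by (simp add: inf_eq K J_def[abs_def])
  qed
qed

end
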